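(* Let $A$ be a finite-dimensional C*-algebra and let $B$ be any C*-algebra such that the posets $\mathcal{C}(A)$ and $\mathcal{C}(B)$ are order isomorphic. Then $A$ and $B$ are *-isomorphic.
   Context: All C*-algebras are assumed to be unital (over $\mathbb{C}$) and nonzero. For a C*-algebra $A$ with unit $1_A$, $\mathcal{C}(A)$ denotes the set of all commutative C*-subalgebras of $A$ that contain $1_A$, partially ordered by inclusion. An order isomorphism between posets is an order-preserving map that has an order-preserving two-sided inverse. *)

theory Defs
  imports Complex_Main
begin

(* Unital nonzero C*-algebras, with underlying real structure taken from the library classes.
   That 0 \<noteq> 1 is part of real_normed_algebra_1; its axiom norm 1 = 1 follows from the C*-identity
   in a nonzero algebra. *)
class cstar_algebra = real_normed_algebra_1 + banach +
  fixes scaleC :: "complex \<Rightarrow> 'a \<Rightarrow> 'a"  (infixr "*\<^sub>C" 75)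
    and star :: "'a \<Rightarrow> 'a"
  assumes scaleC_add_right: "c *\<^sub>C (x + y) = c *\<^sub>C x + c *\<^sub>C y"
    and scaleC_add_left: "(c + d) *\<^sub>C x = c *\<^sub>C x + d *\<^sub>C x"
    and scaleC_scaleC: "c *\<^sub>C d *\<^sub>C x = (c * d) *\<^sub>C x"
    and scaleC_of_real: "complex_of_real r *\<^sub>C x = r *\<^sub>R x"
    and mult_scaleC_left: "(c *\<^sub>C x) * y = c *\<^sub>C (x * y)"
    and mult_scaleC_right: "x * (c *\<^sub>C y) = c *\<^sub>C (x * y)"
    and norm_scaleC: "norm (c *\<^sub>C x) = cmod c * norm x"
    and star_star: "star (star x) = x"
    and star_add: "star (x + y) = star x + star y"
    and star_scaleC: "star (c *\<^sub>C x) = cnj c *\<^sub>C star x"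
    and star_mult: "star (x * y) = star y * star x"
    and norm_star_mult_self: "norm (star x * x) = (norm x)\<^sup>2"

global_interpretation complex_vector:
  vector_space "scaleC :: complex \<Rightarrow> 'a \<Rightarrow> 'a::cstar_algebra"
proof
  show "1 *\<^sub>C x = x" for x :: 'a
    using scaleC_of_real[of 1 x] by simp
qed (simp_all add: scaleC_add_right scaleC_add_left scaleC_scaleC)

instantiation complex :: cstar_algebra
begin

definition scaleC_complex :: "complex \<Rightarrow> complex \<Rightarrow> complex"
  where "scaleC_complex c x = c * x"

definition star_complex :: "complex \<Rightarrow> complex"
  where "star_complex x = cnj x"

instance
  by standard
    (simp_all add: scaleC_complex_def star_complex_def algebra_simps norm_mult
      scaleR_conv_of_real power2_eq_square)

end

definition finite_dim_cstar :: "'a::cstar_algebra itself \<Rightarrow> bool"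
  where "finite_dim_cstar _ \<longleftrightarrow> (\<exists>S :: 'a set. finite S \<and> complex_vector.span S = UNIV)"

definition cstar_subalgebra :: "'a::cstar_algebra set \<Rightarrow> bool"
  where "cstar_subalgebra C \<longleftrightarrow>
    complex_vector.subspace C \<and>
    (\<forall>x\<in>C. \<forall>y\<in>C. x * y \<in> C) \<and>
    (\<forall>x\<in>C. star x \<in> C) \<and>
    closed C"

definition comm_cstar_subalgebras :: "'a::cstar_algebra set set"
  where "comm_cstar_subalgebras =
    {C. cstar_subalgebra C \<and> 1 \<in> C \<and> (\<forall>x\<in>C. \<forall>y\<in>C. x * y = y * x)}"

definition order_isomorphic :: "'a::order set \<Rightarrow> 'b::order set \<Rightarrow> bool"
  where "order_isomorphic P Q \<longleftrightarrow>
    (\<exists>f g. f ` P \<subseteq> Q \<and> g ` Q \<subseteq> P \<and> mono_on P f \<and> mono_on Q g \<and>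
      (\<forall>x\<in>P. g (f x) = x) \<and> (\<forall>y\<in>Q. f (g y) = y))"

definition star_isomorphism :: "('a::cstar_algebra \<Rightarrow> 'b::cstar_algebra) \<Rightarrow> bool"
  where "star_isomorphism f \<longleftrightarrow>
    bij f \<and>
    Vector_Spaces.linear scaleC scaleC f \<and>
    (\<forall>x y. f (x * y) = f x * f y) \<and>
    f 1 = 1 \<and>
    (\<forall>x. f (star x) = star (f x))"

end

theory Submission
  imports Defs "HOL-Analysis.Uniform_Limit"
    "HOL-Computational_Algebra.Formal_Power_Series"
begin

text \<open>
A maximal commutative subalgebra \<open>M\<close> of \<open>A\<close> is spanned by pairwise orthogonal minimal projections
\<open>P\<close>, and \<open>A\<close> is determined up to isomorphism by the equivalence relation \<open>p A q \<noteq> 0\<close> on \<open>P\<close>.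
The order isomorphism maps \<open>M\<close> to a maximal commutative subalgebra of \<open>B\<close>. Chains of commutative
subalgebras of \<open>A\<close>, hence of \<open>B\<close>, have bounded length, which bounds the size of orthogonal families
and forces the image of \<open>M\<close> to be spanned by finitely many minimal projections as well.

The coatoms below \<open>M\<close> correspond to the pairs \<open>{p, q}\<close> in \<open>P\<close>, by identifying the values
at \<open>p\<close> and \<open>q\<close>. The order tells when \<open>p\<close> and \<open>q\<close> are equivalent (the coatom lies in a commutative
subalgebra not contained in \<open>M\<close>) and when two pairs share a point (a third coatom lies above
their meet). From these data one reads off the sizes of the equivalence classes with at least two
elements and the number of projections, hence also the number of singleton classes.
\<close>

section \<open>The C*-identity\<close>

text \<open>Nothing is known about \<open>B\<close> beyond the order isomorphism, so both algebras
  are analysed from a bound on chain lengths alone, without dimension or spectrum. Minimal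
  projections come from an orthogonal family of self-adjoint elements of largest size: a member
  divisible into two orthogonal pieces would allow a larger family. The pieces are cut out by
  positive and negative parts, built from the binomial series of a square root, and connectedness of
  an interval turns indivisibility into scalar action.

  The bijection of pairs given by the coatoms is exploited only through incidence, and an
  incidence-preserving bijection of pairs need not come from a bijection of points: on four points,
  exchanging {1, 2} with {3, 4} and fixing the other pairs preserves incidence, yet sends the three
  pairs through 1 to a triangle. Hence only cardinalities are extracted, and points are matched
  arbitrarily inside matched classes; this is harmless because matrix units make the members of a
  class interchangeable.\<close>

lemma scaleC_one [simp]: "1 *\<^sub>C x = x"
  by (fact complex_vector.scale_one)

lemma scaleC_zero_left [simp]: "0 *\<^sub>C x = 0"
  by (fact complex_vector.scale_zero_left)

lemma scaleC_zero_right [simp]: "c *\<^sub>C (0::'a::cstar_algebra) = 0"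
  by (fact complex_vector.scale_zero_right)

lemma scaleC_eq_0_iff [simp]: "c *\<^sub>C x = 0 \<longleftrightarrow> c = 0 \<or> x = 0"
  by (fact complex_vector.scale_eq_0_iff)

lemma scaleR_eq_scaleC: "r *\<^sub>R x = complex_of_real r *\<^sub>C x"
  by (simp add: scaleC_of_real)

lemma star_scaleR: "star (r *\<^sub>R x) = r *\<^sub>R star x"
  by (simp add: scaleR_eq_scaleC star_scaleC)

lemma star_zero [simp]: "star (0::'a::cstar_algebra) = 0"
  using star_scaleR[of 0 "0::'a"] by simp

lemma star_minus: "star (- x) = - star x"
  using star_scaleR[of "-1" x] by simp

lemma star_diff: "star (x - y) = star x - star y"
  using star_add[of x "- y"] by (simp add: star_minus)

lemma star_one [simp]: "star (1::'a::cstar_algebra) = 1"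
  by (metis mult.right_neutral star_mult star_star mult.left_neutral)

lemma star_sum: "star (sum f A) = (\<Sum>x\<in>A. star (f x))"
  by (induction A rule: infinite_finite_induct) (auto simp: star_add)

lemma star_power: "star (x ^ n) = star x ^ n"
  by (induction n) (auto simp: star_mult power_commutes)

lemma star_eq_0_iff [simp]: "star x = 0 \<longleftrightarrow> x = 0"
  by (metis star_star star_zero)

lemma norm_star [simp]: "norm (star x) = norm x"
proof -
  have le: "norm y \<le> norm (star y)" for y :: 'a
  proof (cases "norm y = 0")
    case False
    have "(norm y)\<^sup>2 \<le> norm (star y) * norm y"
      by (metis norm_mult_ineq norm_star_mult_self)
    with False show ?thesis by (simp add: power2_eq_square)
  qed simp
  from le[of x] le[of "star x"] show ?thesis by (simp add: star_star)
qed

lemma star_mult_self_eq_0_iff [simp]: "star x * x = 0 \<longleftrightarrow> x = 0"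
  by (metis mult_zero_right norm_eq_zero norm_star_mult_self power_eq_0_iff pos2)

lemma selfadjoint_square_eq_0: "star x = x \<Longrightarrow> x * x = 0 \<Longrightarrow> x = 0"
  by (metis star_mult_self_eq_0_iff)

lemma norm_selfadjoint_square: "star x = x \<Longrightarrow> norm (x * x) = (norm x)\<^sup>2"
  by (metis norm_star_mult_self)

lemma bounded_linear_star: "bounded_linear (star :: 'a::cstar_algebra \<Rightarrow> 'a)"
  by (rule bounded_linear_intro[where K = 1]) (auto simp: star_add star_scaleR)

lemma scaleC_diff_right: "c *\<^sub>C (x - y) = c *\<^sub>C x - c *\<^sub>C y"
  by (fact complex_vector.scale_right_diff_distrib)

lemma scaleC_diff_left: "(c - d) *\<^sub>C x = c *\<^sub>C x - d *\<^sub>C x"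
  by (fact complex_vector.scale_left_diff_distrib)

lemma scaleC_cancel_right: "c *\<^sub>C x = d *\<^sub>C x \<longleftrightarrow> c = d \<or> x = 0"
  by (fact complex_vector.scale_cancel_right)

section \<open>Commutants\<close>

definition commutant :: "'a::cstar_algebra set \<Rightarrow> 'a set"
  where "commutant S = {x. \<forall>y\<in>S. x * y = y * x}"

lemma commutantI: "(\<And>y. y \<in> S \<Longrightarrow> x * y = y * x) \<Longrightarrow> x \<in> commutant S"
  by (simp add: commutant_def)

lemma commutantD: "x \<in> commutant S \<Longrightarrow> y \<in> S \<Longrightarrow> x * y = y * x"
  by (simp add: commutant_def)

lemma star_commutant:
  assumes "star ` S \<subseteq> S" "x \<in> commutant S"
  shows "star x \<in> commutant S"
proof (rule commutantI)
  fix y assume "y \<in> S"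
  then have "x * star y = star y * x"
    using assms by (auto simp: commutant_def)
  then have "star (x * star y) = star (star y * x)" by simp
  then show "star x * y = y * star x" by (simp add: star_mult star_star)
qed

lemma closed_commutant: "closed (commutant S)"
proof -
  have "commutant S = (\<Inter>y\<in>S. {x. x * y = y * x})"
    by (auto simp: commutant_def)
  then show ?thesis
    by (auto intro!: closed_INT closed_Collect_eq continuous_intros)
qed

lemma cstar_subalgebra_commutant:
  assumes "star ` S \<subseteq> S"
  shows "cstar_subalgebra (commutant S)"
  unfolding cstar_subalgebra_def
proof (intro conjI ballI)
  show "complex_vector.subspace (commutant S)"
    by (rule complex_vector.subspaceI)
      (auto simp: commutant_def distrib_left distrib_right mult_scaleC_left mult_scaleC_right)
  show "x * y \<in> commutant S" if "x \<in> commutant S" "y \<in> commutant S" for x y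
    using that unfolding commutant_def by simp (metis mult.assoc)
qed (use assms star_commutant closed_commutant in auto)

lemma one_commutant [simp]: "1 \<in> commutant S"
  by (simp add: commutant_def)

text \<open>Elements of \<open>S\<close> commute with each other, so \<open>S\<close> lies in its
  commutant and the bicommutant is commutative. This adjoins a self-adjoint element to a commutative
  algebra with closedness for free, instead of through closures of polynomials.\<close>

lemma bicommutant_mem:
  assumes "star ` S \<subseteq> S" "\<And>x y. x \<in> S \<Longrightarrow> y \<in> S \<Longrightarrow> x * y = y * x"
  shows "commutant (commutant S) \<in> comm_cstar_subalgebras"
proof -
  have "star ` commutant S \<subseteq> commutant S"
    using star_commutant[OF assms(1)] by blast
  moreover have "S \<subseteq> commutant S"
    using assms(2) by (auto simp: commutant_def)
  then have "x * y = y * x" if "x \<in> commutant (commutant S)" "y \<in> commutant (commutant S)" for x y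
    using that unfolding commutant_def by blast
  ultimately show ?thesis
    unfolding comm_cstar_subalgebras_def by (auto simp: cstar_subalgebra_commutant)
qed

lemma subset_bicommutant: "S \<subseteq> commutant (commutant S)"
  by (auto simp: commutant_def)

section \<open>Maximal commutative subalgebras\<close>

definition masa :: "'a::cstar_algebra set \<Rightarrow> bool"
  where "masa M \<longleftrightarrow> M \<in> comm_cstar_subalgebras \<and> (\<forall>N\<in>comm_cstar_subalgebras. M \<subseteq> N \<longrightarrow> N = M)"

lemma comm_cstar_subalgebrasD:
  assumes "C \<in> comm_cstar_subalgebras"
  shows "complex_vector.subspace C" "x \<in> C \<Longrightarrow> y \<in> C \<Longrightarrow> x * y \<in> C"
    "x \<in> C \<Longrightarrow> star x \<in> C" "closed C" "1 \<in> C" "x \<in> C \<Longrightarrow> y \<in> C \<Longrightarrow> x * y = y * x"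
    "x \<in> C \<Longrightarrow> y \<in> C \<Longrightarrow> x + y \<in> C" "x \<in> C \<Longrightarrow> y \<in> C \<Longrightarrow> x - y \<in> C" "x \<in> C \<Longrightarrow> c *\<^sub>C x \<in> C" "0 \<in> C"
  using assms
  by (auto simp: comm_cstar_subalgebras_def cstar_subalgebra_def
      intro: complex_vector.subspace_add complex_vector.subspace_diff
        complex_vector.subspace_scale complex_vector.subspace_0)

lemma selfadjoint_parts:
  obtains a b :: "'a::cstar_algebra" where "star a = a" "star b = b" "x = a + \<i> *\<^sub>C b"
    "a = (1/2) *\<^sub>C (x + star x)" "b = (- \<i> / 2) *\<^sub>C (x - star x)"
proof
  let ?a = "(1/2) *\<^sub>C (x + star x)" and ?b = "(- \<i> / 2) *\<^sub>C (x - star x)"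
  show "star ?a = ?a" by (simp add: star_scaleC star_add star_star add.commute)
  show "star ?b = ?b"
    by (simp add: star_scaleC star_diff star_star scaleC_diff_right complex_vector.scale_minus_left)
  have "?a + \<i> *\<^sub>C ?b = (1/2 + 1/2) *\<^sub>C x"
    unfolding scaleC_add_left by (simp add: scaleC_scaleC scaleC_diff_right scaleC_add_right)
  then show "x = ?a + \<i> *\<^sub>C ?b" by simp
qed (rule refl)+

text \<open>Maximality absorbs any self-adjoint \<open>h\<close> commuting with \<open>M\<close>,
  because \<open>insert h M\<close> lies in a commutative subalgebra. Self-adjoint parts are used
  since nothing says beforehand that a general \<open>x\<close> in the commutant commutes with
  \<open>star x\<close>.\<close>

lemma commutant_masa:
  assumes "masa M"
  shows "commutant M = M"
proof
  have M: "M \<in> comm_cstar_subalgebras" using assms by (simp add: masa_def)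
  show "M \<subseteq> commutant M"
    using comm_cstar_subalgebrasD(6)[OF M] by (auto simp: commutant_def)
  have starM: "star ` M \<subseteq> M" using comm_cstar_subalgebrasD(3)[OF M] by auto
  have sa: "h \<in> M" if h: "star h = h" "h \<in> commutant M" for h
  proof -
    have "commutant (commutant (insert h M)) \<in> comm_cstar_subalgebras"
      using h starM comm_cstar_subalgebrasD(6)[OF M]
      by (intro bicommutant_mem) (auto simp: commutant_def)
    then have "commutant (commutant (insert h M)) = M"
      using assms subset_bicommutant[of "insert h M"] by (auto simp: masa_def)
    then show ?thesis using subset_bicommutant[of "insert h M"] by auto
  qed
  show "commutant M \<subseteq> M"
  proof
    fix x assume x: "x \<in> commutant M"
    obtain a b where ab: "star a = a" "star b = b" "x = a + \<i> *\<^sub>C b"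
      "a = (1/2) *\<^sub>C (x + star x)" "b = (- \<i> / 2) *\<^sub>C (x - star x)"
      by (rule selfadjoint_parts)
    have sub: "complex_vector.subspace (commutant M)"
      using cstar_subalgebra_commutant[OF starM] by (simp add: cstar_subalgebra_def)
    note sx = star_commutant[OF starM x]
    have "a \<in> commutant M"
      by (subst ab(4)) (rule complex_vector.subspace_scale[OF sub complex_vector.subspace_add[OF sub x sx]])
    moreover have "b \<in> commutant M"
      by (subst ab(5)) (rule complex_vector.subspace_scale[OF sub complex_vector.subspace_diff[OF sub x sx]])
    ultimately have "a \<in> M" "b \<in> M" using sa[OF ab(1)] sa[OF ab(2)] by blast+
    then show "x \<in> M"
      by (subst ab(3)) (rule comm_cstar_subalgebrasD(7)[OF M _ comm_cstar_subalgebrasD(9)[OF M]])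
  qed
qed

section \<open>Square roots and absolute values\<close>

text \<open>Coefficients of the binomial series of the square root of \<open>1 - y\<close>, with the
  sign of \<open>(- y) ^ n\<close> absorbed.\<close>

definition sqrt_coeff :: "nat \<Rightarrow> real"
  where "sqrt_coeff n = (-1) ^ n * ((1/2) gchoose n)"

definition sqrt_series :: "'a::{real_normed_algebra_1,banach} \<Rightarrow> 'a"
  where "sqrt_series y = (\<Sum>n. sqrt_coeff n *\<^sub>R y ^ n)"

text \<open>Vandermonde's identity for 1/2 + 1/2 = 1: squaring the series has to produce the
  coefficients of \<open>1 - y\<close>.\<close>

lemma sqrt_coeff_convolution:
  "(\<Sum>i\<le>n. sqrt_coeff i * sqrt_coeff (n - i)) = (if n = 0 then 1 else if n = 1 then -1 else 0)"
proof -
  have "(\<Sum>i\<le>n. sqrt_coeff i * sqrt_coeff (n - i))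
      = (-1) ^ n * (\<Sum>i\<le>n. ((1/2) gchoose i) * ((1/2) gchoose (n - i)))"
    unfolding sum_distrib_left
    by (rule sum.cong) (auto simp: sqrt_coeff_def power_add[symmetric])
  also have "\<dots> = (-1) ^ n * ((1::real) gchoose n)"
    using gbinomial_Vandermonde[of "1/2 :: real" "1/2" n] by (simp add: atMost_atLeast0)
  also have "(1::real) gchoose n = of_nat (1 choose n)"
    using binomial_gbinomial[of 1 n, where 'a = real] by simp
  also have "(-1) ^ n * real (1 choose n) = (if n = 0 then 1 else if n = 1 then -1 else 0)"
    by (cases "n \<le> 1") (auto simp: le_Suc_eq binomial_eq_0)
  finally show ?thesis .
qed

lemma sqrt_coeff_0 [simp]: "sqrt_coeff 0 = 1"
  by (simp add: sqrt_coeff_def)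

lemma sqrt_coeff_Suc: "sqrt_coeff (Suc n) = sqrt_coeff n * (real n - 1/2) / (real n + 1)"
  using gbinomial_mult_1[of "1/2 :: real" n]
  by (cases "even n") (simp_all add: sqrt_coeff_def field_simps)

lemma sqrt_coeff_nonpos: "sqrt_coeff (Suc n) \<le> 0"
proof (induction n)
  case 0 then show ?case by (simp add: sqrt_coeff_def)
next
  case (Suc n)
  then show ?case
    by (subst sqrt_coeff_Suc) (auto intro!: divide_nonpos_pos mult_nonpos_nonneg)
qed

text \<open>The partial sums have the closed form \<open>- 2 * (n + 1) * sqrt_coeff (n + 1)\<close>,
  and every coefficient after the one at 0 is nonpositive.\<close>

lemma sum_sqrt_coeff_nonneg: "0 \<le> (\<Sum>k\<le>n. sqrt_coeff k)"
proof -
  have *: "(\<Sum>k\<le>n. sqrt_coeff k) = - 2 * real (Suc n) * sqrt_coeff (Suc n)"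
  proof (induction n)
    case 0 then show ?case by (simp add: sqrt_coeff_def)
  next
    case (Suc n)
    then show ?case
      using sqrt_coeff_Suc[of "Suc n"] by (simp add: field_simps)
  qed
  then show ?thesis using sqrt_coeff_nonpos[of n]
    by (simp add: mult_nonneg_nonpos2 mult_nonpos_nonpos)
qed

text \<open>Only the coefficient at 0, which is 1, is positive, so the absolute values add up to 2
  minus a nonnegative partial sum. The square root series therefore converges on the closed unit
  ball, boundary included.\<close>

lemma summable_abs_sqrt_coeff: "summable (\<lambda>n. \<bar>sqrt_coeff n\<bar>)"
proof (rule bounded_imp_summable)
  fix n
  have "(\<Sum>k\<le>n. \<bar>sqrt_coeff k\<bar>) = 2 - (\<Sum>k\<le>n. sqrt_coeff k)"
    by (induction n) (use sqrt_coeff_nonpos in \<open>auto simp: abs_of_nonpos\<close>)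
  then show "(\<Sum>k\<le>n. \<bar>sqrt_coeff k\<bar>) \<le> 2"
    using sum_sqrt_coeff_nonneg[of n] by simp
qed auto

lemma norm_sqrt_term_le:
  fixes y :: "'a::{real_normed_algebra_1,banach}"
  assumes "norm y \<le> 1"
  shows "norm (sqrt_coeff n *\<^sub>R y ^ n) \<le> \<bar>sqrt_coeff n\<bar>"
proof -
  have "norm (y ^ n) \<le> 1"
    using norm_power_ineq[of y n] power_le_one[OF norm_ge_zero assms, of n] by linarith
  then show ?thesis by (simp add: mult_left_le)
qed

lemma summable_norm_sqrt_series:
  fixes y :: "'a::{real_normed_algebra_1,banach}"
  assumes "norm y \<le> 1"
  shows "summable (\<lambda>n. norm (sqrt_coeff n *\<^sub>R y ^ n))"
  by (rule summable_comparison_test'[OF summable_abs_sqrt_coeff, of 0])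
    (use norm_sqrt_term_le[OF assms] in auto)

lemma sqrt_series_sums:
  fixes y :: "'a::{real_normed_algebra_1,banach}"
  assumes "norm y \<le> 1"
  shows "(\<lambda>n. sqrt_coeff n *\<^sub>R y ^ n) sums sqrt_series y"
  unfolding sqrt_series_def
  by (rule summable_sums, rule summable_norm_cancel, rule summable_norm_sqrt_series, fact)

lemma sqrt_series_square:
  fixes y :: "'a::{real_normed_algebra_1,banach}"
  assumes "norm y \<le> 1"
  shows "sqrt_series y * sqrt_series y = 1 - y"
proof -
  let ?a = "\<lambda>n. sqrt_coeff n *\<^sub>R y ^ n"
  have "(\<lambda>n. \<Sum>i\<le>n. ?a i * ?a (n - i)) sums (sqrt_series y * sqrt_series y)"
    unfolding sqrt_series_def
    by (intro Cauchy_product_sums summable_norm_sqrt_series assms)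
  moreover have "(\<Sum>i\<le>n. ?a i * ?a (n - i)) = (if n = 0 then 1 else if n = 1 then - y else 0)" for n
  proof -
    have "(\<Sum>i\<le>n. ?a i * ?a (n - i)) = (\<Sum>i\<le>n. sqrt_coeff i * sqrt_coeff (n - i)) *\<^sub>R y ^ n"
      unfolding scaleR_sum_left
      by (rule sum.cong) (auto simp: power_add[symmetric] mult.commute)
    then show ?thesis by (simp add: sqrt_coeff_convolution)
  qed
  moreover have "(\<lambda>n. if n = 0 then 1 else if n = 1 then - y else 0) sums (1 - y)"
    using sums_finite[of "{0, 1}" "\<lambda>n. if n = 0 then 1 else if n = 1 then - y else 0"]
    by simp
  ultimately show ?thesis using sums_unique2 by fastforce
qed

lemma sqrt_series_0 [simp]: "sqrt_series (0::'a::{real_normed_algebra_1,banach}) = 1"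
  using suminf_finite[of "{0}" "\<lambda>n. sqrt_coeff n *\<^sub>R (0::'a::{real_normed_algebra_1,banach}) ^ n"]
  by (simp add: sqrt_series_def power_0_left)

lemma continuous_on_sqrt_series:
  "continuous_on (cball 0 1) (sqrt_series :: 'a::{real_normed_algebra_1,banach} \<Rightarrow> 'a)"
proof (rule uniform_limit_theorem)
  show "uniform_limit (cball 0 1) (\<lambda>n (y::'a). \<Sum>i<n. sqrt_coeff i *\<^sub>R y ^ i) sqrt_series sequentially"
    unfolding sqrt_series_def
    by (rule Weierstrass_m_test[OF _ summable_abs_sqrt_coeff])
      (rule norm_sqrt_term_le, simp)
qed (auto intro!: always_eventually continuous_intros)

lemma commute_sqrt_series:
  fixes y :: "'a::{real_normed_algebra_1,banach}"
  assumes "norm y \<le> 1" "x * y = y * x"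
  shows "x * sqrt_series y = sqrt_series y * x"
proof -
  have "x * y ^ n = y ^ n * x" for n
    using power_commuting_commutes[OF assms(2)[symmetric], of n] by simp
  then have "(\<lambda>n. sqrt_coeff n *\<^sub>R y ^ n * x) sums (x * sqrt_series y)"
    using sums_mult[OF sqrt_series_sums[OF assms(1)], of x] by simp
  then show ?thesis
    using sums_mult2[OF sqrt_series_sums[OF assms(1)], of x] sums_unique2 by blast
qed

lemma star_sqrt_series:
  assumes "norm y \<le> 1" "star y = y"
  shows "star (sqrt_series y) = sqrt_series y"
proof -
  have "(\<lambda>n. sqrt_coeff n *\<^sub>R y ^ n) sums star (sqrt_series y)"
    using bounded_linear.sums[OF bounded_linear_star sqrt_series_sums[OF assms(1)]] assms(2)
    by (simp add: star_scaleR star_power)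
  then show ?thesis using sqrt_series_sums[OF assms(1)] sums_unique2 by blast
qed

text \<open>With \<open>k = sqrt_series (h\<^sup>2)\<close> the element \<open>h + i k\<close> is unitary, and \<open>1 - h\<^sup>2 = k\<^sup>2\<close>
  with \<open>k\<close> its imaginary part; this replaces an appeal to the spectrum.\<close>

lemma norm_one_minus_square_le:
  assumes h: "star h = h" "norm h \<le> 1"
  shows "norm (1 - h * h) \<le> 1"
proof -
  have hh: "norm (h * h) \<le> 1" "star (h * h) = h * h"
    using h by (auto simp: norm_selfadjoint_square abs_square_le_1 star_mult)
  define k where "k = sqrt_series (h * h)"
  have k: "star k = k" "k * k = 1 - h * h" "h * k = k * h"
    unfolding k_def using hh sqrt_series_square star_sqrt_series
    by (auto intro: commute_sqrt_series simp: mult.assoc)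
  define u where "u = h + \<i> *\<^sub>C k"
  have su: "star u = h - \<i> *\<^sub>C k"
    by (simp add: u_def star_add star_scaleC h k complex_vector.scale_minus_left)
  have "star u * u = 1"
    unfolding su unfolding u_def
    by (simp add: algebra_simps mult_scaleC_left mult_scaleC_right scaleC_scaleC k
        scaleC_diff_right complex_vector.scale_minus_left)
  then have "norm u = 1"
    using norm_star_mult_self[of u] power2_eq_imp_eq[of "norm u" 1] by simp
  have "u - star u = (\<i> + \<i>) *\<^sub>C k"
    unfolding su unfolding u_def scaleC_add_left by simp
  then have "2 * norm k = norm (u - star u)"
    by (simp add: norm_scaleC norm_mult)
  also have "\<dots> \<le> 2"
    using norm_triangle_ineq4[of u "star u"] \<open>norm u = 1\<close> by simp
  finally have "norm k \<le> 1" by simp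
  then show ?thesis
    using norm_selfadjoint_square[OF k(1)] k(2) by (simp add: abs_square_le_1)
qed

text \<open>The square root of \<open>h * h\<close>, with \<open>h * h\<close> written as
  \<open>1 - (1 - h * h)\<close> to fit the series; for a self-adjoint contraction
  \<open>norm_one_minus_square_le\<close> puts the argument into the unit ball.\<close>

definition absolute :: "'a::cstar_algebra \<Rightarrow> 'a"
  where "absolute h = sqrt_series (1 - h * h)"

lemma absolute:
  assumes "star h = h" "norm h \<le> 1"
  shows "absolute h * absolute h = h * h" "star (absolute h) = absolute h"
    "x * h = h * x \<Longrightarrow> x * absolute h = absolute h * x"
proof -
  have "x * (1 - h * h) = (1 - h * h) * x" if xh: "x * h = h * x"
  proof -
    have "x * (h * h) = h * h * x" by (metis xh mult.assoc)
    then show ?thesis by (simp add: right_diff_distrib left_diff_distrib)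
  qed
  then show "absolute h * absolute h = h * h" "star (absolute h) = absolute h"
    "x * h = h * x \<Longrightarrow> x * absolute h = absolute h * x"
    unfolding absolute_def using norm_one_minus_square_le[OF assms] assms
    by (auto simp: sqrt_series_square intro!: star_sqrt_series commute_sqrt_series)
      (simp_all add: star_diff star_mult)
qed

lemma absolute_one [simp]: "absolute 1 = 1" "absolute (- 1) = 1"
  by (simp_all add: absolute_def)

lemma continuous_on_absolute:
  "continuous_on {h. star h = h \<and> norm h \<le> 1} (absolute :: 'a::cstar_algebra \<Rightarrow> 'a)"
  unfolding absolute_def
  by (rule continuous_on_compose2[OF continuous_on_sqrt_series])
    (auto intro!: continuous_intros norm_one_minus_square_le)

section \<open>Chains of commutative subalgebras\<close>

text \<open>\<open>n\<close> counts the strict inclusions, so there are \<open>n + 1\<close>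
  members, of which \<open>E 0\<close> is the largest.\<close>

definition strict_chain :: "nat \<Rightarrow> (nat \<Rightarrow> 'a::cstar_algebra set) \<Rightarrow> bool"
  where "strict_chain n E \<longleftrightarrow>
    (\<forall>k\<le>n. E k \<in> comm_cstar_subalgebras) \<and> (\<forall>k<n. E (Suc k) \<subset> E k)"

definition chain_bounded :: "'a::cstar_algebra itself \<Rightarrow> nat \<Rightarrow> bool"
  where "chain_bounded _ K \<longleftrightarrow> (\<forall>n (E :: nat \<Rightarrow> 'a set). strict_chain n E \<longrightarrow> n \<le> K)"

text \<open>Climbing from \<open>E n\<close> to \<open>E 0\<close>, every strict inclusion
  contributes a vector outside the span of those collected so far, so a chain yields
  \<open>n\<close> independent vectors.\<close>

lemma finite_dim_chain_bounded:
  assumes "finite_dim_cstar TYPE('a::cstar_algebra)"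
  obtains K where "chain_bounded TYPE('a) K"
proof -
  obtain S :: "'a set" where S: "finite S" "complex_vector.span S = UNIV"
    using assms unfolding finite_dim_cstar_def by blast
  have "n \<le> card S" if E: "strict_chain n E" for n and E :: "nat \<Rightarrow> 'a set"
  proof -
    have "\<exists>X. X \<subseteq> E (n - m) \<and> complex_vector.independent X \<and> finite X \<and> card X = m"
      if "m \<le> n" for m
      using that
    proof (induction m)
      case 0
      show ?case by (rule exI[of _ "{}"]) (simp add: complex_vector.independent_empty)
    next
      case (Suc m)
      then obtain X where X: "X \<subseteq> E (n - m)" "complex_vector.independent X" "finite X" "card X = m"
        by auto
      have eq: "n - m = Suc (n - Suc m)" using Suc.prems by simp
      have "E (n - m) \<subset> E (n - Suc m)"
        using E Suc.prems unfolding eq strict_chain_def by auto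
      then obtain x where x: "x \<in> E (n - Suc m)" "x \<notin> E (n - m)" by blast
      have "E (n - m) \<in> comm_cstar_subalgebras"
        using E by (auto simp: strict_chain_def)
      then have "complex_vector.span X \<subseteq> E (n - m)"
        using X(1) by (intro complex_vector.span_minimal comm_cstar_subalgebrasD(1))
      then have "x \<notin> complex_vector.span X" using x by blast
      then have "complex_vector.independent (insert x X)" "x \<notin> X"
        using X(2) complex_vector.independent_insertI complex_vector.span_base by blast+
      then show ?case
        using X x \<open>E (n - m) \<subset> E (n - Suc m)\<close>
        by (intro exI[of _ "insert x X"]) auto
    qed
    from this[OF order_refl] obtain X :: "'a set" where X: "complex_vector.independent X" "finite X" "card X = n"
      by blast
    then show ?thesis
      using complex_vector.independent_span_bound[OF S(1) X(1)] S(2) by auto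
  qed
  then show ?thesis using that unfolding chain_bounded_def by blast
qed

lemma order_isomorphic_bij_betw:
  assumes "order_isomorphic P Q"
  obtains f where "bij_betw f P Q" "\<And>x y. x \<in> P \<Longrightarrow> y \<in> P \<Longrightarrow> f x \<le> f y \<longleftrightarrow> x \<le> y"
proof -
  obtain f g where fg: "f ` P \<subseteq> Q" "g ` Q \<subseteq> P" "mono_on P f" "mono_on Q g"
    "\<forall>x\<in>P. g (f x) = x" "\<forall>y\<in>Q. f (g y) = y"
    using assms unfolding order_isomorphic_def by auto
  show ?thesis
  proof
    show "bij_betw f P Q"
      using fg by (intro bij_betw_byWitness[of _ g]) auto
    show "f x \<le> f y \<longleftrightarrow> x \<le> y" if "x \<in> P" "y \<in> P" for x y
      using that fg by (metis image_subset_iff monotone_onD)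
  qed
qed

text \<open>A chain pulled back along the inverse stays strict. The resulting bound is all that is
  known about the size of the second algebra.\<close>

lemma chain_bounded_transfer:
  assumes "chain_bounded TYPE('a::cstar_algebra) K"
    and "bij_betw f (comm_cstar_subalgebras :: 'a set set)
      (comm_cstar_subalgebras :: 'b::cstar_algebra set set)"
    and "\<And>x y. x \<in> comm_cstar_subalgebras \<Longrightarrow> y \<in> comm_cstar_subalgebras \<Longrightarrow> f x \<le> f y \<longleftrightarrow> x \<le> y"
  shows "chain_bounded TYPE('b) K"
  unfolding chain_bounded_def
proof (intro allI impI)
  fix n and E :: "nat \<Rightarrow> 'b set" assume E: "strict_chain n E"
  define g where "g = the_inv_into comm_cstar_subalgebras f"
  have g: "g y \<in> comm_cstar_subalgebras" "f (g y) = y" if "y \<in> comm_cstar_subalgebras" for y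
    using that assms(2) unfolding g_def bij_betw_def
    by (auto simp: f_the_inv_into_f intro: the_inv_into_into)
  have "strict_chain n (\<lambda>k. g (E k))"
    unfolding strict_chain_def
  proof (intro conjI allI impI)
    fix k assume "k < n"
    then have "E (Suc k) \<subset> E k" "E (Suc k) \<in> comm_cstar_subalgebras" "E k \<in> comm_cstar_subalgebras"
      using E by (auto simp: strict_chain_def)
    then show "g (E (Suc k)) \<subset> g (E k)"
      using assms(3) g by (metis order_less_le)
  qed (use E g in \<open>auto simp: strict_chain_def\<close>)
  then show "n \<le> K" using assms(1) by (auto simp: chain_bounded_def)
qed

text \<open>The top of a longest chain is maximal, since a larger algebra could be put above
  it.\<close>

lemma masa_exists:
  assumes "chain_bounded TYPE('a::cstar_algebra) K"
  obtains M :: "'a::cstar_algebra set" where "masa M"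
proof -
  let ?P = "\<lambda>n. \<exists>E :: nat \<Rightarrow> 'a set. strict_chain n E"
  \<comment> \<open>This is the centre; it supplies a chain without inclusions to start
    from.\<close>
  have "commutant (commutant {}) \<in> (comm_cstar_subalgebras :: 'a set set)"
    by (rule bicommutant_mem) auto
  then have "strict_chain 0 (\<lambda>_. commutant (commutant {}) :: 'a set)"
    by (simp add: strict_chain_def)
  then have "?P 0" by blast
  moreover have "\<forall>n. ?P n \<longrightarrow> n \<le> K"
    using assms by (auto simp: chain_bounded_def)
  ultimately obtain n where n: "?P n" "\<And>m. ?P m \<Longrightarrow> m \<le> n"
    using Nat.ex_has_greatest_nat[of ?P 0 K] by blast
  then obtain E :: "nat \<Rightarrow> 'a set" where E: "strict_chain n E" by blast
  have "masa (E 0)"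
    unfolding masa_def
  proof (intro conjI ballI impI)
    show "E 0 \<in> comm_cstar_subalgebras" using E by (simp add: strict_chain_def)
    fix N assume N: "N \<in> comm_cstar_subalgebras" "E 0 \<subseteq> N"
    show "N = E 0"
    proof (rule ccontr)
      assume "N \<noteq> E 0"
      then have "strict_chain (Suc n) (case_nat N E)"
        using E N by (auto simp: strict_chain_def split: nat.splits)
      then have "Suc n \<le> n" using n(2) by blast
      then show False by simp
    qed
  qed
  then show ?thesis using that by blast
qed

text \<open>One scalar has to serve all of \<open>G\<close>. Along a growing orthogonal family these
  sets form the descending chain that bounds its size; for two minimal projections they are the
  coatoms below \<open>M\<close>.\<close>

definition scalar_on :: "'a::cstar_algebra set \<Rightarrow> 'a set \<Rightarrow> 'a set"
  where "scalar_on M G = {x \<in> M. \<exists>c. \<forall>g\<in>G. x * g = c *\<^sub>C g}"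

text \<open>As \<open>h\<close> is nonzero, convergence of \<open>x n * h\<close> makes the scalars
  a Cauchy sequence, and their limit serves every member of \<open>G\<close>.\<close>

lemma closed_scalar_on:
  fixes M :: "'a::cstar_algebra set"
  assumes "closed M" "h \<in> G" "h \<noteq> 0"
  shows "closed (scalar_on M G)"
  unfolding closed_sequential_limits
proof (intro allI impI)
  fix x :: "nat \<Rightarrow> 'a" and l
  assume "(\<forall>n. x n \<in> scalar_on M G) \<and> x \<longlonglongrightarrow> l"
  then have x: "\<And>n. x n \<in> scalar_on M G" "x \<longlonglongrightarrow> l" by auto
  then have "\<forall>n. \<exists>c. \<forall>g\<in>G. x n * g = c *\<^sub>C g" by (simp add: scalar_on_def)
  then obtain c where c: "\<And>n g. g \<in> G \<Longrightarrow> x n * g = c n *\<^sub>C g" by metis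
  have lim: "(\<lambda>n. x n * g) \<longlonglongrightarrow> l * g" for g
    using x(2) by (intro tendsto_intros)
  have "Cauchy c"
  proof (rule metric_CauchyI)
    fix e :: real assume "e > 0"
    then have "e * norm h > 0" using assms by simp
    then obtain N where N: "\<And>m n. m \<ge> N \<Longrightarrow> n \<ge> N \<Longrightarrow> dist (x m * h) (x n * h) < e * norm h"
      using LIMSEQ_imp_Cauchy[OF lim[of h]] unfolding Cauchy_def by blast
    have "dist (x m * h) (x n * h) = dist (c m) (c n) * norm h" for m n
      using c[OF assms(2)] by (simp add: dist_norm norm_scaleC flip: scaleC_diff_left)
    then show "\<exists>N. \<forall>m\<ge>N. \<forall>n\<ge>N. dist (c m) (c n) < e"
      using N assms by (intro exI[of _ N]) auto
  qed
  then obtain d where d: "c \<longlonglongrightarrow> d" using Cauchy_convergent_iff convergent_def by blast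
  have "l * g = d *\<^sub>C g" if "g \<in> G" for g
  proof -
    have "(r *\<^sub>R z) *\<^sub>C g = r *\<^sub>R (z *\<^sub>C g)" for r z
      by (simp add: scaleR_conv_of_real[of r z] scaleR_eq_scaleC[of r "z *\<^sub>C g"] scaleC_scaleC)
    then have "bounded_linear (\<lambda>c. c *\<^sub>C g)"
      by (intro bounded_linear_intro[where K = "norm g"]) (auto simp: scaleC_add_left norm_scaleC)
    then have "(\<lambda>n. c n *\<^sub>C g) \<longlonglongrightarrow> d *\<^sub>C g" using d by (rule bounded_linear.tendsto)
    then show ?thesis using lim[of g] c[OF that] LIMSEQ_unique by simp
  qed
  moreover have "l \<in> M"
    using closed_sequentially[OF assms(1) _ x(2)] x(1) by (simp add: scalar_on_def)
  ultimately show "l \<in> scalar_on M G" by (auto simp: scalar_on_def)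
qed

lemma scalar_on_mem:
  assumes M: "M \<in> comm_cstar_subalgebras" and G: "G \<subseteq> M" "\<And>g. g \<in> G \<Longrightarrow> star g = g"
    and h: "h \<in> G" "h \<noteq> 0"
  shows "scalar_on M G \<in> comm_cstar_subalgebras"
  unfolding comm_cstar_subalgebras_def cstar_subalgebra_def mem_Collect_eq
proof (intro conjI ballI)
  note D = comm_cstar_subalgebrasD[OF M]
  show "complex_vector.subspace (scalar_on M G)"
  proof (rule complex_vector.subspaceI)
    show "0 \<in> scalar_on M G" using D(10) by (auto simp: scalar_on_def intro!: exI[of _ 0])
    show "x + y \<in> scalar_on M G" if "x \<in> scalar_on M G" "y \<in> scalar_on M G" for x y
      using that D(7) unfolding scalar_on_def by (auto simp: distrib_right simp flip: scaleC_add_left)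
    show "c *\<^sub>C x \<in> scalar_on M G" if "x \<in> scalar_on M G" for x c
      using that D(9) unfolding scalar_on_def by (auto simp: mult_scaleC_left scaleC_scaleC)
  qed
  show "x * y \<in> scalar_on M G" if "x \<in> scalar_on M G" "y \<in> scalar_on M G" for x y
    using that D(2) unfolding scalar_on_def by (auto simp: mult.assoc mult_scaleC_right scaleC_scaleC)
  show "star x \<in> scalar_on M G" if x: "x \<in> scalar_on M G" for x
  proof -
    obtain c where c: "x \<in> M" "\<And>g. g \<in> G \<Longrightarrow> x * g = c *\<^sub>C g"
      using x by (auto simp: scalar_on_def)
    have "star x * g = cnj c *\<^sub>C g" if "g \<in> G" for g
    proof -
      have "star x * g = g * star x" using that c(1) D(3,6) G by blast
      also have "\<dots> = star (x * g)" using G that by (simp add: star_mult)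
      also have "\<dots> = cnj c *\<^sub>C g" using G that c(2) by (simp add: star_scaleC)
      finally show ?thesis .
    qed
    then show ?thesis using c(1) D(3) by (auto simp: scalar_on_def)
  qed
  show "closed (scalar_on M G)" using closed_scalar_on D(4) h by blast
  show "1 \<in> scalar_on M G" using D(5) by (auto simp: scalar_on_def intro!: exI[of _ 1])
  show "x * y = y * x" if "x \<in> scalar_on M G" "y \<in> scalar_on M G" for x y
    using that D(6) by (auto simp: scalar_on_def)
qed

text \<open>Members need not be idempotent, because dividing an element yields multiples by positive
  and negative parts rather than projections. Normalising waits until every square is known to be a
  multiple of the element.\<close>

definition orthogonal_family :: "'a::cstar_algebra set \<Rightarrow> 'a set \<Rightarrow> bool"
  where "orthogonal_family M F \<longleftrightarrow> finite F \<and> F \<subseteq> M \<and>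
    (\<forall>f\<in>F. star f = f \<and> f \<noteq> 0) \<and> (\<forall>f\<in>F. \<forall>g\<in>F. f \<noteq> g \<longrightarrow> f * g = 0)"

text \<open>The elements of \<open>M\<close> acting as a scalar on \<open>f\<^sub>0, \<dots>, f\<^sub>k\<close> form a chain that is strictly
  decreasing in \<open>k\<close>.\<close>

lemma card_orthogonal_family_le:
  assumes K: "chain_bounded TYPE('a::cstar_algebra) K"
    and M: "(M :: 'a set) \<in> comm_cstar_subalgebras" and F: "orthogonal_family M F"
  shows "card F \<le> Suc K"
proof (cases "card F")
  case (Suc n)
  have fin: "finite F" using F by (simp add: orthogonal_family_def)
  obtain f where f: "bij_betw f {0..<card F} F"
    using ex_bij_betw_nat_finite[OF fin] by blast
  have fF: "f i \<in> F" if "i \<le> n" for i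
    using bij_betwE[OF f] that Suc by simp
  have orth: "f i * f j = 0" if "i \<le> n" "j \<le> n" "i \<noteq> j" for i j
  proof -
    have "f i \<noteq> f j" using f that Suc by (auto simp: bij_betw_def inj_on_def)
    then show ?thesis using F fF that by (simp add: orthogonal_family_def)
  qed
  have f': "f i \<in> M" "star (f i) = f i" "f i \<noteq> 0" if "i \<le> n" for i
    using fF[OF that] F by (auto simp: orthogonal_family_def)
  define E where "E = (\<lambda>k. scalar_on M (f ` {..k}))"
  have "strict_chain n E"
    unfolding strict_chain_def
  proof (intro conjI allI impI)
    show "E k \<in> comm_cstar_subalgebras" if "k \<le> n" for k
      unfolding E_def using that f' by (intro scalar_on_mem[OF M, of _ "f 0"]) auto
    fix k assume k: "k < n"
    \<comment> \<open>\<open>f (Suc k)\<close> acts as 0 on the earlier members, while its square is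
      nonzero; so no single scalar serves once \<open>f (Suc k)\<close> itself joins the
      set.\<close>
    have "f (Suc k) \<in> E k"
      using orth f' k by (auto simp: E_def scalar_on_def intro!: exI[of _ 0])
    moreover have "f (Suc k) \<notin> E (Suc k)"
    proof
      assume "f (Suc k) \<in> E (Suc k)"
      then obtain c where c: "\<And>i. i \<le> Suc k \<Longrightarrow> f (Suc k) * f i = c *\<^sub>C f i"
        by (auto simp: E_def scalar_on_def)
      then have "c *\<^sub>C f 0 = 0" using orth[of "Suc k" 0] k by auto
      then have "c = 0" using f' by simp
      then have "f (Suc k) * f (Suc k) = 0" using c by auto
      then show False using f'[of "Suc k"] k selfadjoint_square_eq_0 by auto
    qed
    moreover have "E (Suc k) \<subseteq> E k" by (auto simp: E_def scalar_on_def)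
    ultimately show "E (Suc k) \<subset> E k" by blast
  qed
  then have "n \<le> K" using K unfolding chain_bounded_def by blast
  then show ?thesis using Suc by simp
qed simp

section \<open>Minimal projections\<close>

text \<open>The two zero sets below are closed, cover \<open>[-1, 1]\<close>, and each contains an endpoint;
  where they meet, \<open>y u\<close> annihilates \<open>f\<close>.\<close>

lemma corner_scalar_contraction:
  assumes M: "masa M" and f: "f \<in> M" "f \<noteq> 0"
    and split: "\<And>a b. a \<in> M \<Longrightarrow> b \<in> M \<Longrightarrow> star a = a \<Longrightarrow> star b = b \<Longrightarrow> a * b = 0 \<Longrightarrow> a * f = 0 \<or> b * f = 0"
    and x: "x \<in> M" "star x = x" "norm x \<le> 1"
  shows "\<exists>c. x * f = c *\<^sub>C f"
proof -
  note D = comm_cstar_subalgebrasD[OF conjunct1[OF M[unfolded masa_def]]]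
  \<comment> \<open>A path of self-adjoint contractions in \<open>M\<close> from -1 to 1, passing
    through \<open>x\<close> at \<open>u = 0\<close>.\<close>
  define y where "y = (\<lambda>u::real. u *\<^sub>R 1 + (1 - \<bar>u\<bar>) *\<^sub>R x)"
  have y: "star (y u) = y u" "norm (y u) \<le> 1" "y u \<in> M" if "u \<in> {-1..1}" for u
  proof -
    show "star (y u) = y u" by (simp add: y_def star_add star_scaleR x)
    have "norm (y u) \<le> \<bar>u\<bar> * 1 + (1 - \<bar>u\<bar>) * norm x"
      unfolding y_def by (rule norm_triangle_le) (use that in auto)
    also have "\<dots> \<le> \<bar>u\<bar> * 1 + (1 - \<bar>u\<bar>) * 1"
      using that x(3) by (intro add_left_mono mult_left_mono) auto
    finally show "norm (y u) \<le> 1" by simp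
    show "y u \<in> M" unfolding y_def scaleR_eq_scaleC by (intro D(7) D(9) D(5) x(1))
  qed
  have abs_y: "absolute (y u) * absolute (y u) = y u * y u" "star (absolute (y u)) = absolute (y u)"
    "absolute (y u) \<in> M" if u: "u \<in> {-1..1}" for u
  proof -
    have "absolute (y u) \<in> commutant M"
      using absolute(3)[OF y(1,2)[OF u]] D(6) y(3)[OF u] by (metis commutantI)
    then show "absolute (y u) \<in> M" using commutant_masa[OF M] by simp
    show "absolute (y u) * absolute (y u) = y u * y u" "star (absolute (y u)) = absolute (y u)"
      by (rule absolute[OF y(1,2)[OF u]])+
  qed
  have cont: "continuous_on {-1..1} y"
    unfolding y_def by (intro continuous_intros)
  have conta: "continuous_on {-1..1} (\<lambda>u. absolute (y u))"
    by (rule continuous_on_compose2[OF continuous_on_absolute cont]) (use y in auto)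
  \<comment> \<open>On \<open>U\<close> the positive part of \<open>y u\<close> annihilates
    \<open>f\<close>, on \<open>V\<close> the negative part does. These parts have product 0, so
    \<open>split\<close> makes the two sets cover the interval.\<close>
  define U where "U = {u \<in> {-1..1}. (absolute (y u) + y u) * f = 0}"
  define V where "V = {u \<in> {-1..1}. (absolute (y u) - y u) * f = 0}"
  have "closed U" "closed V"
    unfolding U_def V_def
    by (intro continuous_closed_preimage_constant continuous_intros cont conta closed_atLeastAtMost)+
  moreover have "{-1..1} \<subseteq> U \<union> V"
  proof
    fix u :: real assume u: "u \<in> {-1..1}"
    have "absolute (y u) * y u = y u * absolute (y u)" using abs_y(3) y(3) D(6) u by blast
    then have "(absolute (y u) + y u) * (absolute (y u) - y u) = 0"
      using abs_y(1)[OF u] by (simp add: algebra_simps)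
    then show "u \<in> U \<union> V"
      unfolding U_def V_def using split[of "absolute (y u) + y u" "absolute (y u) - y u"]
        y[OF u] abs_y[OF u] D(7,8) u by (auto simp: star_add star_diff)
  qed
  moreover have "- 1 \<in> U" "1 \<in> V" by (auto simp: U_def V_def y_def)
  ultimately obtain u where u: "u \<in> U" "u \<in> V"
    using connected_closedD[of "{-1..1::real}" U V] connected_Icc by fastforce
  then have "(absolute (y u) + y u) * f - (absolute (y u) - y u) * f = 0"
    by (simp add: U_def V_def)
  then have "2 *\<^sub>R (y u * f) = 0" by (simp add: algebra_simps scaleR_2)
  then have yf: "u *\<^sub>R f + (1 - \<bar>u\<bar>) *\<^sub>R (x * f) = 0" by (simp add: y_def distrib_right)
  \<comment> \<open>If \<open>u\<close> were 1 or -1, the equation \<open>yf\<close> would reduce to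
    \<open>u *\<^sub>R f = 0\<close>.\<close>
  have "1 - \<bar>u\<bar> \<noteq> 0" using yf f(2) by auto
  then have "x * f = inverse (1 - \<bar>u\<bar>) *\<^sub>R ((1 - \<bar>u\<bar>) *\<^sub>R (x * f))" by simp
  also have "(1 - \<bar>u\<bar>) *\<^sub>R (x * f) = (- u) *\<^sub>R f"
    using yf by (simp add: eq_neg_iff_add_eq_0 add.commute)
  finally show ?thesis unfolding scaleR_eq_scaleC scaleC_scaleC by blast
qed

text \<open>Rescaling extends the contraction case to self-adjoint elements, and real and imaginary
  parts extend it to \<open>M\<close>. The hypothesis \<open>split\<close> is the indivisibility of
  \<open>f\<close> that a family of largest size will provide.\<close>

lemma corner_scalar:
  assumes M: "masa M" and f: "f \<in> M" "f \<noteq> 0"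
    and split: "\<And>a b. a \<in> M \<Longrightarrow> b \<in> M \<Longrightarrow> star a = a \<Longrightarrow> star b = b \<Longrightarrow> a * b = 0 \<Longrightarrow> a * f = 0 \<or> b * f = 0"
    and x: "x \<in> M"
  shows "\<exists>c. x * f = c *\<^sub>C f"
proof -
  note D = comm_cstar_subalgebrasD[OF conjunct1[OF M[unfolded masa_def]]]
  have sa: "\<exists>c. a * f = c *\<^sub>C f" if a: "a \<in> M" "star a = a" for a
  proof (cases "a = 0")
    case False
    let ?b = "inverse (norm a) *\<^sub>R a"
    have "?b \<in> M" unfolding scaleR_eq_scaleC using a by (intro D(9))
    then have "\<exists>c. ?b * f = c *\<^sub>C f"
      using a False
      by (intro corner_scalar_contraction[OF M f split]) (auto simp: star_scaleR)
    then obtain c where "?b * f = c *\<^sub>C f" by blast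
    then have "norm a *\<^sub>R (?b * f) = norm a *\<^sub>R c *\<^sub>C f" by simp
    then show ?thesis using False unfolding scaleR_eq_scaleC
      by (auto simp: scaleC_scaleC mult_scaleC_left)
  qed (auto intro: exI[of _ 0])
  obtain a b where ab: "star a = a" "star b = b" "x = a + \<i> *\<^sub>C b"
    "a = (1/2) *\<^sub>C (x + star x)" "b = (- \<i> / 2) *\<^sub>C (x - star x)"
    by (rule selfadjoint_parts)
  have "a \<in> M" by (subst ab(4)) (intro D(9) D(7) D(3) x)
  moreover have "b \<in> M" by (subst ab(5)) (intro D(9) D(8) D(3) x)
  ultimately obtain c d where "a * f = c *\<^sub>C f" "b * f = d *\<^sub>C f" using sa ab(1,2) by blast
  then have "x * f = (c + \<i> * d) *\<^sub>C f"
    by (subst ab(3)) (simp add: distrib_right mult_scaleC_left scaleC_add_left scaleC_scaleC)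
  then show ?thesis by blast
qed

text \<open>Minimality is one-dimensionality of the corner at \<open>p\<close>, with
  \<open>x\<close> ranging over the whole algebra and not just over the commutant of
  \<open>P\<close>. Off-diagonal corners are controlled through it.\<close>

locale minimal_frame =
  fixes P :: "'a::cstar_algebra set"
  assumes finite_frame: "finite P"
    and star_frame: "p \<in> P \<Longrightarrow> star p = p"
    and idem: "p \<in> P \<Longrightarrow> p * p = p"
    and nonzero: "p \<in> P \<Longrightarrow> p \<noteq> 0"
    and orth: "p \<in> P \<Longrightarrow> q \<in> P \<Longrightarrow> p \<noteq> q \<Longrightarrow> p * q = 0"
    and sum_frame: "\<Sum>P = 1"
    and minimal: "p \<in> P \<Longrightarrow> \<exists>c. p * x * p = c *\<^sub>C p"

text \<open>The largest size of \<open>F\<close> is used twice: it forbids the division of a member,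
  which makes \<open>M\<close> act on each member by scalars, and it forces the normalised members
  to sum to 1.\<close>

theorem masa_minimal_frame:
  assumes K: "chain_bounded TYPE('a::cstar_algebra) K" and M: "masa (M :: 'a set)"
  obtains P :: "'a::cstar_algebra set" where "minimal_frame P" "M = commutant P"
proof -
  have MC: "M \<in> comm_cstar_subalgebras" using M by (simp add: masa_def)
  note D = comm_cstar_subalgebrasD[OF MC]
  have "orthogonal_family M {}" by (simp add: orthogonal_family_def)
  then have "\<exists>F. orthogonal_family M F \<and> (\<forall>G. orthogonal_family M G \<longrightarrow> card G \<le> card F)"
    using card_orthogonal_family_le[OF K MC]
    by (intro ex_has_greatest_nat[where b = "Suc (Suc K)"]) (auto simp: less_Suc_eq_le)
  then obtain F where F: "orthogonal_family M F" "\<And>G. orthogonal_family M G \<Longrightarrow> card G \<le> card F"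
    by blast
  note F' = F(1)[unfolded orthogonal_family_def]
  have scal: "\<exists>c. x * f = c *\<^sub>C f" if f: "f \<in> F" and x: "x \<in> M" for x f
  proof (rule corner_scalar[OF M _ _ _ x])
    show "f \<in> M" "f \<noteq> 0" using F' f by auto
    fix a b assume ab: "a \<in> M" "b \<in> M" "star a = a" "star b = b" "a * b = 0"
    show "a * f = 0 \<or> b * f = 0"
    proof (rule ccontr)
      assume "\<not> ?thesis"
      then have nz: "a * f \<noteq> 0" "b * f \<noteq> 0" by auto
      have fM: "f \<in> M" "star f = f" using F' f by auto
      let ?F = "F - {f}"
      have mul: "z * f \<in> M" "star (z * f) = z * f" "\<And>g. g \<in> ?F \<Longrightarrow> (z * f) * g = 0 \<and> g * (z * f) = 0"
        if z: "z \<in> M" "star z = z" for z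
      proof -
        show "z * f \<in> M" "star (z * f) = z * f"
          using z fM D(2,6) by (auto simp: star_mult)
        fix g assume "g \<in> ?F"
        then have "f * g = 0" "g \<in> M" using F' f by auto
        then show "(z * f) * g = 0 \<and> g * (z * f) = 0"
          using \<open>z * f \<in> M\<close> D(6) by (metis mult.assoc mult_zero_right)
      qed
      have abf: "(a * f) * (b * f) = 0" "(b * f) * (a * f) = 0"
      proof -
        have "(a * f) * (b * f) = (a * b) * (f * f)"
          using D(6)[OF fM(1) ab(2)] by (metis mult.assoc)
        then show "(a * f) * (b * f) = 0" using ab by simp
        then show "(b * f) * (a * f) = 0" using D(6) mul(1)[OF ab(1,3)] mul(1)[OF ab(2,4)] by metis
      qed
      have ne: "a * f \<noteq> b * f" "a * f \<notin> ?F" "b * f \<notin> ?F"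
        using abf nz mul[OF ab(1,3)] mul[OF ab(2,4)] selfadjoint_square_eq_0 by metis+
      have "orthogonal_family M (insert (a * f) (insert (b * f) ?F))"
        using F' abf nz mul[OF ab(1,3)] mul[OF ab(2,4)] unfolding orthogonal_family_def by auto
      then have "card (insert (a * f) (insert (b * f) ?F)) \<le> card F" by (rule F(2))
      moreover have "card (insert (a * f) (insert (b * f) ?F)) = Suc (card F)"
        using ne F' f by (simp add: card_Diff_singleton) (metis Suc_pred card_gt_0_iff empty_iff)
      ultimately show False by simp
    qed
  qed
  have "\<exists>p. star p = p \<and> p * p = p \<and> p \<noteq> 0 \<and> (\<exists>c. c \<noteq> 0 \<and> p = c *\<^sub>C f)" if f: "f \<in> F" for f
  proof -
    have f': "star f = f" "f \<noteq> 0" "f \<in> M" using F' f by auto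
    obtain c where c: "f * f = c *\<^sub>C f" using scal[OF f f'(3)] by blast
    have c0: "c \<noteq> 0" using c f' selfadjoint_square_eq_0 by force
    have "star (f * f) = f * f" using f' by (simp add: star_mult)
    then have "cnj c = c" using c f' by (simp add: star_scaleC scaleC_cancel_right)
    then show ?thesis
      using c c0 f' by (intro exI[of _ "inverse c *\<^sub>C f"] conjI exI[of _ "inverse c"])
        (auto simp: star_scaleC mult_scaleC_left mult_scaleC_right scaleC_scaleC)
  qed
  then obtain p where p: "\<And>f. f \<in> F \<Longrightarrow> star (p f) = p f \<and> p f * p f = p f \<and> p f \<noteq> 0 \<and> (\<exists>c. c \<noteq> 0 \<and> p f = c *\<^sub>C f)"
    by metis
  have pM: "p f \<in> M" if "f \<in> F" for f using p[OF that] F' that D(9) by auto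
  have orthp: "p f * p g = 0" if "f \<in> F" "g \<in> F" "f \<noteq> g" for f g
    using p[OF that(1)] p[OF that(2)] F' that by (auto simp: mult_scaleC_left mult_scaleC_right)
  have injp: "inj_on p F"
    by (rule inj_onI) (metis orthp p)
  have scalp: "\<exists>c. x * p f = c *\<^sub>C p f" if f: "f \<in> F" and x: "x \<in> M" for x f
  proof -
    obtain c where "x * f = c *\<^sub>C f" using scal[OF f x] by blast
    then have "x * p f = c *\<^sub>C p f"
      using p[OF f] by (auto simp: mult_scaleC_right scaleC_scaleC mult.commute)
    then show ?thesis by blast
  qed
  define q where "q = 1 - (\<Sum>f\<in>F. p f)"
  have qp: "q * p f = 0" if f: "f \<in> F" for f
  proof -
    have "(\<Sum>g\<in>F. p g) * p f = (\<Sum>g\<in>F. if g = f then p f else 0)"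
      unfolding sum_distrib_right by (rule sum.cong) (use orthp p f in auto)
    then show ?thesis using F' f by (simp add: q_def left_diff_distrib)
  qed
  have sq: "star q = q" using p by (simp add: q_def star_diff star_sum)
  have qM: "q \<in> M"
    unfolding q_def using pM by (intro D(8) D(5) complex_vector.subspace_sum[OF D(1)])
  have qf: "q * f = 0" if f: "f \<in> F" for f
    using qp[OF f] p[OF f] by (auto simp: mult_scaleC_right)
  have q0: "q = 0"
  proof (rule ccontr)
    assume nz: "q \<noteq> 0"
    have "q \<notin> F" using qf[of q] nz sq selfadjoint_square_eq_0 by blast
    moreover have "orthogonal_family M (insert q F)"
      using F' nz qM sq qf D(6)[OF qM] unfolding orthogonal_family_def by (metis finite_insert insert_iff insert_subset subsetD)
    then have "card (insert q F) \<le> card F" by (rule F(2))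
    ultimately show False using F' by simp
  qed
  show ?thesis
  proof
    \<comment> \<open>Every \<open>m\<close> in \<open>M\<close> is a combination of the
      projections, so commuting with these suffices for membership in \<open>commutant M\<close>,
      which is \<open>M\<close>.\<close>
    have comm: "x \<in> M" if x: "\<And>f. f \<in> F \<Longrightarrow> x * p f = p f * x" for x
    proof -
      have "x * m = m * x" if m: "m \<in> M" for m
      proof -
        have "\<forall>f\<in>F. \<exists>c. m * p f = c *\<^sub>C p f" using scalp m by blast
        then obtain c where c: "\<And>f. f \<in> F \<Longrightarrow> m * p f = c f *\<^sub>C p f" by metis
        have "m = (\<Sum>f\<in>F. m * p f)"
          using q0 by (simp add: q_def flip: sum_distrib_left)
        then have "m = (\<Sum>f\<in>F. c f *\<^sub>C p f)" using c by simp
        then show ?thesis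
          using x by (simp add: sum_distrib_left sum_distrib_right mult_scaleC_left mult_scaleC_right)
      qed
      then show ?thesis using commutant_masa[OF M] by (auto simp: commutant_def)
    qed
    show "minimal_frame (p ` F)"
    proof
      show "\<Sum>(p ` F) = 1" using q0 by (simp add: sum.reindex[OF injp] q_def)
      fix p' assume "p' \<in> p ` F"
      then obtain f where f: "f \<in> F" "p' = p f" by auto
      fix x
      \<comment> \<open>The compression commutes with all the projections, so it lies in
        \<open>M\<close> even if \<open>x\<close> does not, and the scalar action of
        \<open>M\<close> applies to it.\<close>
      have "p f * x * p f * p g = p g * (p f * x * p f)" if "g \<in> F" for g
        using that f orthp[of f g] orthp[of g f] p[of f]
        by (cases "f = g") (metis mult.assoc, metis mult.assoc mult_zero_left mult_zero_right)
      then have "p f * x * p f \<in> M" using comm by blast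
      then obtain c where "p f * x * p f * p f = c *\<^sub>C p f" using scalp f by blast
      then show "\<exists>c. p' * x * p' = c *\<^sub>C p'" using f p[of f] by (metis mult.assoc)
    qed (use F' p orthp in auto)
    show "M = commutant (p ` F)"
    proof
      show "M \<subseteq> commutant (p ` F)" using pM D(6) by (auto simp: commutant_def)
      show "commutant (p ` F) \<subseteq> M" using comm by (auto simp: commutant_def)
    qed
  qed
qed

section \<open>Matrix units\<close>

context minimal_frame
begin

lemma sum_mult_left: "(\<Sum>p\<in>P. p * x) = x"
  using sum_frame by (simp flip: sum_distrib_right)

lemma sum_mult_right: "(\<Sum>p\<in>P. x * p) = x"
  using sum_frame by (simp flip: sum_distrib_left)

lemma sum_corners: "(\<Sum>p\<in>P. \<Sum>q\<in>P. p * x * q) = x"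
  by (simp add: sum_mult_left sum_mult_right)

lemma frame_mult: "p \<in> P \<Longrightarrow> q \<in> P \<Longrightarrow> p * q = (if p = q then p else 0)"
  by (simp add: idem orth)

lemma frame_mult_left: "p \<in> P \<Longrightarrow> q \<in> P \<Longrightarrow> p * (q * x) = (if p = q then p * x else 0)"
  by (simp add: frame_mult flip: mult.assoc)

text \<open>For minimal projections this amounts to Murray-von Neumann equivalence, by
  \<open>partial_isometry\<close>; the classes are the matrix blocks of the algebra.\<close>

definition linked :: "('a \<times> 'a) set"
  where "linked = {(p, q). p \<in> P \<and> q \<in> P \<and> (\<exists>x. p * x * q \<noteq> 0)}"

lemma linkedD: "(p, q) \<in> linked \<Longrightarrow> p \<in> P" "(p, q) \<in> linked \<Longrightarrow> q \<in> P"
  by (auto simp: linked_def)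

lemma finite_linked: "finite linked"
  by (rule finite_subset[of _ "P \<times> P"]) (auto simp: linked_def finite_frame)

text \<open>Positivity of \<open>star w * w\<close>. If it were \<open>c q\<close> with \<open>c < 0\<close> and \<open>p \<noteq> q\<close>, then
  \<open>h = w + star w\<close> would square to \<open>c (p + q)\<close>, and \<open>u = h + i \<surd>(-c) (p + q)\<close>
  would satisfy \<open>star u * u = 0\<close>.\<close>

lemma corner_positive:
  assumes p: "p \<in> P" and q: "q \<in> P" and w: "p * w = w" "w * q = w" "w \<noteq> 0"
    and c: "star w * w = complex_of_real c *\<^sub>C q" "w * star w = complex_of_real c *\<^sub>C p"
  shows "c > 0"
proof (rule ccontr)
  assume "\<not> c > 0"
  then have c0: "c \<le> 0" by simp
  have sw: "star w * p = star w" "q * star w = star w"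
    using arg_cong[OF w(1), of star] arg_cong[OF w(2), of star] p q
    by (simp_all add: star_mult star_frame)
  show False
  proof (cases "p = q")
    \<comment> \<open>Here the corner is one-dimensional, so \<open>w\<close> is a multiple of
      \<open>p\<close> and \<open>c\<close> is a squared modulus.\<close>
    case True
    then obtain l where "w = l *\<^sub>C p" using minimal[OF p, of w] w by auto
    then have "complex_of_real c *\<^sub>C p = (cnj l * l) *\<^sub>C p"
      using c(1) p True
      by (auto simp: star_scaleC star_frame idem mult_scaleC_left mult_scaleC_right scaleC_scaleC
          mult.commute)
    then have "complex_of_real c = complex_of_real ((cmod l)\<^sup>2)"

      unfolding complex_norm_square using nonzero[OF p] by (simp add: scaleC_cancel_right mult.commute)
    then have "c = (cmod l)\<^sup>2" by (simp only: of_real_eq_iff)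
    then have "l = 0" using c0 by simp
    then show False using w \<open>w = l *\<^sub>C p\<close> by simp
  next
    case False
    have 0: "q * p = 0" "p * q = 0" using False orth p q by auto
    have wp: "w * p = 0"
      using arg_cong[OF 0(1), of "(*) w"] w(2) by (simp flip: mult.assoc)
    have pw: "q * w = 0" "p * star w = 0" "star w * q = 0"
      using arg_cong[OF 0(1), of "\<lambda>x. x * w"] arg_cong[OF 0(2), of "\<lambda>x. x * star w"]
        arg_cong[OF 0(2), of "(*) (star w)"] w(1) sw by (simp_all add: mult.assoc) (simp add: sw flip: mult.assoc)
    have "w * w = w * q * (p * w)" using w(1,2) by simp
    also have "\<dots> = w * (q * p) * w" by (simp only: mult.assoc)
    finally have ww: "w * w = 0" using 0 by simp
    then have ww': "star w * star w = 0" by (metis star_mult star_zero)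
    define g where "g = p + q"
    define h where "h = w + star w"
    define s where "s = complex_of_real (sqrt (- c))"
    have s2: "s * s = - complex_of_real c" "cnj s = s"
      using c0 by (simp_all add: s_def flip: of_real_mult)
    have hg: "h * g = h" "g * h = h" "g * g = g" "star h = h" "star g = g"
      using w sw wp pw False p q
      by (simp_all add: h_def g_def distrib_left distrib_right frame_mult star_add star_star star_frame add.commute)
    have hh: "h * h = complex_of_real c *\<^sub>C g"
      using c ww ww' by (simp add: h_def g_def distrib_left distrib_right scaleC_add_right add.commute)
    define u where "u = h + (\<i> * s) *\<^sub>C g"
    have su: "star u = h - (\<i> * s) *\<^sub>C g"
      using s2 by (simp add: u_def star_add star_scaleC hg complex_vector.scale_minus_left)
    have "star u * u = h * h - (\<i> * s * (\<i> * s)) *\<^sub>C g"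
      unfolding su unfolding u_def
      by (simp add: left_diff_distrib distrib_left mult_scaleC_left mult_scaleC_right hg scaleC_scaleC
          scaleC_diff_right)
    also have "\<i> * s * (\<i> * s) = complex_of_real c"
      using s2 by (metis mult.assoc mult.left_commute i_squared mult_minus1 minus_minus)
    finally have "star u * u = 0" by (simp add: hh)
    then have "u = 0" by simp
    \<comment> \<open>Adding the adjoint cancels the \<open>g\<close> term and leaves
      \<open>h + h\<close>; multiplying \<open>h = 0\<close> by \<open>p\<close> then isolates
      \<open>w\<close>.\<close>
    then have "u + star u = 0" by simp
    then have "h + h = 0" unfolding su unfolding u_def by simp
    then have "h = 0" by (simp flip: scaleR_2)
    then have "p * (w + star w) = 0" by (simp add: h_def)
    then have "w = 0" unfolding distrib_left w(1) pw(2) by simp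
    then show False using w by simp
  qed
qed

text \<open>For a nonzero corner \<open>w = p * x * q\<close>, minimality makes
  \<open>star w * w\<close> and \<open>w * star w\<close> multiples of \<open>q\<close> and
  \<open>p\<close>, and evaluating \<open>w * star w * w\<close> in two ways shows that the factors
  agree. The common factor is positive by \<open>corner_positive\<close>; dividing \<open>w\<close>
  by its square root gives \<open>v\<close>.\<close>

lemma partial_isometry:
  assumes "(p, q) \<in> linked"
  shows "\<exists>v. p * v = v \<and> v * q = v \<and> star v * v = q \<and> v * star v = p"
proof -
  obtain x where x: "p \<in> P" "q \<in> P" "p * x * q \<noteq> 0" using assms by (auto simp: linked_def)
  define w where "w = p * x * q"
  have w: "p * w = w" "w * q = w" "w \<noteq> 0"
    using x by (simp_all add: w_def idem mult.assoc frame_mult_left)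
  have sw: "star w * p = star w" "q * star w = star w"
    using arg_cong[OF w(1), of star] arg_cong[OF w(2), of star] x
    by (simp_all add: star_mult star_frame)
  obtain c where c: "star w * w = c *\<^sub>C q"
    using minimal[OF x(2), of "star w * w"] w sw by (metis mult.assoc)
  obtain d where d: "w * star w = d *\<^sub>C p"
    using minimal[OF x(1), of "w * star w"] w sw by (metis mult.assoc)
  have "c *\<^sub>C w = w * (star w * w)" using w by (simp add: c mult_scaleC_right)
  also have "\<dots> = d *\<^sub>C w" using w d by (simp add: mult_scaleC_left flip: mult.assoc)
  finally have cd: "d = c" using w by (simp add: scaleC_cancel_right)
  have "star (star w * w) = star w * w" by (simp add: star_mult star_star)
  then have "cnj c = c"
    using x nonzero by (simp add: c star_scaleC star_frame scaleC_cancel_right)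
  then obtain r where r: "c = complex_of_real r"
    by (metis Reals_cnj_iff Reals_cases)
  have "r > 0" using corner_positive[OF x(1,2) w] c d cd r by simp
  then have s: "inverse (complex_of_real (sqrt r)) * (inverse (complex_of_real (sqrt r)) * complex_of_real r) = 1"
    by (simp add: field_simps flip: of_real_mult)
  show ?thesis
    by (rule exI[of _ "inverse (complex_of_real (sqrt r)) *\<^sub>C w"])
      (use w s in \<open>simp add: star_scaleC mult_scaleC_left mult_scaleC_right c d cd r scaleC_scaleC mult.assoc\<close>)
qed

lemma linkedI: "p \<in> P \<Longrightarrow> q \<in> P \<Longrightarrow> p * x * q \<noteq> 0 \<Longrightarrow> (p, q) \<in> linked"
  by (auto simp: linked_def)

text \<open>Only transitivity needs an idea. A product of nonzero corners might vanish, but for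
  partial isometries \<open>star v\<close> sends \<open>v * w\<close> back to the nonzero
  \<open>w\<close>.\<close>

lemma equiv_linked: "equiv P linked"
proof (rule equivI)
  show "linked \<subseteq> P \<times> P" by (auto simp: linked_def)
  show "refl_on P linked"
  proof (rule refl_onI)
    show "(p, p) \<in> linked" if "p \<in> P" for p
      using linkedI[OF that that, of 1] that by (simp add: idem nonzero)
  qed
  show "sym linked"
  proof (rule symI)
    fix p q assume "(p, q) \<in> linked"
    then obtain x where x: "p \<in> P" "q \<in> P" "p * x * q \<noteq> 0" by (auto simp: linked_def)
    then have "star (p * x * q) \<noteq> 0" by simp
    then have "q * star x * p \<noteq> 0" using x by (simp add: star_mult star_frame mult.assoc)
    then show "(q, p) \<in> linked" using x linkedI by blast
  qed
  show "trans linked"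
  proof (rule transI)
    fix p q s assume pq: "(p, q) \<in> linked" and qs: "(q, s) \<in> linked"
    obtain v where v: "p * v = v" "v * q = v" "star v * v = q"
      using partial_isometry[OF pq] by blast
    obtain w where w: "q * w = w" "w * s = w" "star w * w = s"
      using partial_isometry[OF qs] by blast
    have "star v * (p * (v * w) * s) = w"
      using v w by (metis mult.assoc)
    moreover have "w \<noteq> 0" using w(3) nonzero[OF linkedD(2)[OF qs]] by (metis mult_zero_right)
    ultimately have "p * (v * w) * s \<noteq> 0" by auto
    then show "(p, s) \<in> linked" using linkedI linkedD pq qs by blast
  qed
qed

end

text \<open>Nothing is prescribed for \<open>e p q\<close> at unlinked pairs, where the corner is
  zero and contains no unit.\<close>

locale matrix_units = minimal_frame +
  fixes e :: "'a \<Rightarrow> 'a \<Rightarrow> 'a"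
  assumes units_mult: "(p, q) \<in> linked \<Longrightarrow> (q, s) \<in> linked \<Longrightarrow> e p q * e q s = e p s"
    and units_star: "(p, q) \<in> linked \<Longrightarrow> star (e p q) = e q p"
    and units_diag: "p \<in> P \<Longrightarrow> e p p = p"

text \<open>With one projection \<open>rep\<close> fixed in each class and \<open>v p\<close> a
  partial isometry from \<open>rep p\<close> onto \<open>p\<close>, the units are
  \<open>v p * star (v q)\<close>: in a product the inner factor \<open>star (v q) * v q\<close>
  collapses to the common representative.\<close>

lemma (in minimal_frame) matrix_units_exist:
  obtains e where "matrix_units P e"
proof -
  define rep where "rep = (\<lambda>p. SOME q. (p, q) \<in> linked)"
  have rep: "(p, rep p) \<in> linked" if "p \<in> P" for p
  proof -
    have "(p, p) \<in> linked" using equiv_linked that by (auto simp: equiv_def refl_on_def)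
    then show ?thesis unfolding rep_def by (rule someI)
  qed
  \<comment> \<open>Linked projections are linked to the same elements, so \<open>SOME\<close> is
    applied to equal predicates.\<close>
  have rep_eq: "rep p = rep q" if "(p, q) \<in> linked" for p q
  proof -
    have "(p, s) \<in> linked \<longleftrightarrow> (q, s) \<in> linked" for s
      using equiv_linked that by (meson equivE symD transD)
    then show ?thesis by (simp add: rep_def)
  qed
  have "\<forall>p\<in>P. \<exists>v. v * rep p = v \<and> star v * v = rep p \<and> v * star v = p"
    using partial_isometry rep by blast
  then obtain v where v: "\<And>p. p \<in> P \<Longrightarrow> v p * rep p = v p \<and> star (v p) * v p = rep p \<and> v p * star (v p) = p"
    by metis
  have "matrix_units P (\<lambda>p q. v p * star (v q))"
  proof
    show "v p * star (v q) * (v q * star (v s)) = v p * star (v s)"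
      if "(p, q) \<in> linked" "(q, s) \<in> linked" for p q s
      using v[OF linkedD(2)[OF that(1)]] v[OF linkedD(1)[OF that(1)]] rep_eq[OF that(1)]
      by (metis mult.assoc)
  qed (use v in \<open>auto simp: star_mult star_star\<close>)
  then show ?thesis using that by blast
qed

section \<open>Matrix coefficients with respect to the units\<close>

context matrix_units
begin

lemma linked_sym: "(p, q) \<in> linked \<Longrightarrow> (q, p) \<in> linked"
  using equiv_linked by (meson equivE symD)

lemma linked_refl: "p \<in> P \<Longrightarrow> (p, p) \<in> linked"
  using equiv_linked by (auto simp: equiv_def refl_on_def)

lemma linked_trans: "(p, q) \<in> linked \<Longrightarrow> (q, s) \<in> linked \<Longrightarrow> (p, s) \<in> linked"
  using equiv_linked by (meson equivE transD)

lemma units_mult_left: "(p, q) \<in> linked \<Longrightarrow> s \<in> P \<Longrightarrow> s * e p q = (if s = p then e p q else 0)"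
  using units_mult[of p p q] linkedD[of p q] linked_refl[of p]
  by (metis frame_mult_left mult_zero_left units_diag frame_mult mult.assoc)

lemma units_mult_right: "(p, q) \<in> linked \<Longrightarrow> s \<in> P \<Longrightarrow> e p q * s = (if s = q then e p q else 0)"
  using units_mult[of p q q] linkedD[of p q] linked_refl[of q]
  by (metis mult_zero_right units_diag frame_mult mult.assoc)

lemma units_nonzero: "(p, q) \<in> linked \<Longrightarrow> e p q \<noteq> 0"
  using units_mult[of p q p] linked_sym[of p q] linkedD[of p q] units_diag[of p] nonzero[of p]
  by auto

text \<open>The default 0 at unlinked pairs keeps \<open>coef\<close> linear at every pair and lets
  the sums in matrix products range over all of \<open>P\<close>.\<close>

definition coef :: "'a \<Rightarrow> 'a \<Rightarrow> 'a \<Rightarrow> complex"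
  where "coef x p q = (if (p, q) \<in> linked then SOME c. p * x * q = c *\<^sub>C e p q else 0)"

lemma coef_unlinked: "(p, q) \<notin> linked \<Longrightarrow> coef x p q = 0"
  by (simp add: coef_def)

text \<open>Inserting \<open>q = e q p * e p q\<close> turns the corner into a diagonal one followed
  by \<open>e p q\<close>, where minimality of \<open>p\<close> gives the scalar. At unlinked pairs
  both sides vanish.\<close>

lemma corner_coef:
  assumes "p \<in> P" "q \<in> P"
  shows "p * x * q = coef x p q *\<^sub>C e p q"
proof (cases "(p, q) \<in> linked")
  case True
  obtain c where c: "p * (x * e q p) * p = c *\<^sub>C p" using minimal[OF assms(1)] by blast
  have "p * x * q = p * x * (e q p * e p q)"
    using units_mult[OF linked_sym[OF True] True] units_diag assms by simp
  also have "\<dots> = p * (x * e q p) * p * e p q"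
    using units_mult_left[OF True assms(1)] by (simp add: mult.assoc)
  also have "\<dots> = c *\<^sub>C e p q"
    using c units_mult_left[OF True assms(1)] by (simp add: mult_scaleC_left)
  finally have "\<exists>c. p * x * q = c *\<^sub>C e p q" by blast
  then show ?thesis using True by (auto simp: coef_def intro: someI_ex)
next
  case False
  then show ?thesis using assms linkedI by (auto simp: coef_def)
qed

lemma coef_eqI:
  assumes "(p, q) \<in> linked" "p * x * q = c *\<^sub>C e p q"
  shows "coef x p q = c"
  using corner_coef[OF linkedD[OF assms(1)], of x] assms units_nonzero
  by (simp add: scaleC_cancel_right)

lemma coef_add: "coef (x + y) p q = coef x p q + coef y p q"
proof (cases "(p, q) \<in> linked")
  case True
  then show ?thesis using corner_coef[OF linkedD[OF True]]
    by (intro coef_eqI) (simp_all add: distrib_left distrib_right scaleC_add_left)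
qed (simp add: coef_unlinked)

lemma coef_scaleC: "coef (c *\<^sub>C x) p q = c * coef x p q"
proof (cases "(p, q) \<in> linked")
  case True
  then show ?thesis using corner_coef[OF linkedD[OF True]]
    by (intro coef_eqI) (simp_all add: mult_scaleC_left mult_scaleC_right scaleC_scaleC)
qed (simp add: coef_unlinked)

lemma coef_star: "coef (star x) p q = cnj (coef x q p)"
proof (cases "(p, q) \<in> linked")
  case True
  have "p * star x * q = star (q * x * p)"
    using linkedD[OF True] by (simp add: star_mult star_frame mult.assoc)
  also have "\<dots> = cnj (coef x q p) *\<^sub>C e p q"
    using linkedD[OF True] units_star[OF linked_sym[OF True]] by (simp add: corner_coef star_scaleC)
  finally show ?thesis using True by (intro coef_eqI)
next
  case False
  then show ?thesis using linked_sym by (auto simp: coef_def)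
qed

lemma coef_one: "p \<in> P \<Longrightarrow> q \<in> P \<Longrightarrow> coef 1 p q = (if p = q then 1 else 0)"
  using linked_refl
  by (cases "(p, q) \<in> linked") (auto simp: frame_mult units_diag coef_unlinked intro!: coef_eqI)

lemma coef_mult:
  assumes "p \<in> P" "q \<in> P"
  shows "coef (x * y) p q = (\<Sum>s\<in>P. coef x p s * coef y s q)"
proof (cases "(p, q) \<in> linked")
  case True
  have "p * (x * y) * q = (\<Sum>s\<in>P. p * x * s * (s * y * q))"
  proof -
    have "p * (x * y) * q = p * x * (\<Sum>s\<in>P. s * (y * q))" by (simp add: sum_mult_left mult.assoc)
    also have "\<dots> = (\<Sum>s\<in>P. p * x * s * (s * y * q))"
      unfolding sum_distrib_left by (rule sum.cong) (auto simp: mult.assoc frame_mult_left)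
    finally show ?thesis .
  qed
  also have "\<dots> = (\<Sum>s\<in>P. (coef x p s * coef y s q) *\<^sub>C e p q)"
  proof (rule sum.cong)
    fix s assume s: "s \<in> P"
    show "p * x * s * (s * y * q) = (coef x p s * coef y s q) *\<^sub>C e p q"
    proof (cases "(p, s) \<in> linked")
      case ps: True
      then have "(s, q) \<in> linked" using True linked_trans linked_sym by blast
      then show ?thesis
        using ps units_mult[of p s q]
        by (simp add: corner_coef assms s mult_scaleC_left mult_scaleC_right scaleC_scaleC)
    next
      case False
      then show ?thesis by (simp add: corner_coef assms s coef_def[of x p s])
    qed
  qed simp
  also have "\<dots> = (\<Sum>s\<in>P. coef x p s * coef y s q) *\<^sub>C e p q"
    by (rule complex_vector.scale_sum_left[symmetric])
  finally show ?thesis using True by (intro coef_eqI)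
next
  case False
  then have 0: "coef x p s * coef y s q = 0" for s
    using linked_trans coef_unlinked by (metis mult_eq_0_iff)
  then show ?thesis by (simp only: coef_unlinked[OF False] 0 sum.neutral_const)
qed

lemma coef_ext:
  assumes "\<And>p q. p \<in> P \<Longrightarrow> q \<in> P \<Longrightarrow> coef x p q = coef y p q"
  shows "x = y"
proof -
  have "(\<Sum>p\<in>P. \<Sum>q\<in>P. p * x * q) = (\<Sum>p\<in>P. \<Sum>q\<in>P. p * y * q)"
    by (intro sum.cong refl) (simp add: corner_coef assms)
  then show ?thesis by (simp add: sum_corners)
qed

text \<open>Together with \<open>coef_ext\<close> this identifies the algebra with all matrices
  indexed by \<open>P\<close> and supported on \<open>linked\<close>.\<close>

lemma coef_surj:
  assumes "\<And>p q. p \<in> P \<Longrightarrow> q \<in> P \<Longrightarrow> (p, q) \<notin> linked \<Longrightarrow> k p q = 0"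
  shows "\<exists>x. \<forall>p\<in>P. \<forall>q\<in>P. coef x p q = k p q"
proof (intro exI ballI)
  fix p q assume pq: "p \<in> P" "q \<in> P"
  let ?x = "\<Sum>(a, b)\<in>linked. k a b *\<^sub>C e a b"
  show "coef ?x p q = k p q"
  proof (cases "(p, q) \<in> linked")
    case True
    have "p * ?x * q = (\<Sum>(a, b)\<in>linked. p * (k a b *\<^sub>C e a b) * q)"
      by (simp add: sum_distrib_left sum_distrib_right case_prod_beta)
    also have "\<dots> = (\<Sum>ab\<in>linked. if ab = (p, q) then k p q *\<^sub>C e p q else 0)"
    proof (rule sum.cong)
      fix ab assume ab: "ab \<in> linked"
      obtain a b where [simp]: "ab = (a, b)" by fastforce
      show "(case ab of (a, b) \<Rightarrow> p * (k a b *\<^sub>C e a b) * q) = (if ab = (p, q) then k p q *\<^sub>C e p q else 0)"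
        using ab pq units_mult_left[of a b p] units_mult_right[of a b q]
        by (auto simp: mult_scaleC_left mult_scaleC_right)
    qed simp
    also have "\<dots> = k p q *\<^sub>C e p q" using True by (simp add: finite_linked)
    finally show ?thesis using True by (intro coef_eqI)
  next
    case False
    then show ?thesis using assms pq by (simp add: coef_def)
  qed
qed

end

text \<open>All operations are determined by coefficients, so relabelling matrices respects them.
  The map \<open>t\<close> runs from \<open>Q\<close> to \<open>P\<close> because the coefficient of
  \<open>f x\<close> at \<open>p\<close>, \<open>q\<close> is that of \<open>x\<close> at
  \<open>t p\<close>, \<open>t q\<close>.\<close>

lemma matrix_units_star_isomorphism:
  fixes P :: "'a::cstar_algebra set" and Q :: "'b::cstar_algebra set"
  assumes "matrix_units P e" "matrix_units Q d"
    and t: "bij_betw t Q P"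
    and linked: "\<And>p q. p \<in> Q \<Longrightarrow> q \<in> Q \<Longrightarrow>
      (t p, t q) \<in> minimal_frame.linked P \<longleftrightarrow> (p, q) \<in> minimal_frame.linked Q"
  shows "\<exists>f :: 'a \<Rightarrow> 'b. star_isomorphism f"
proof -
  interpret A: matrix_units P e by fact
  interpret B: matrix_units Q d by fact
  have tP: "t p \<in> P" if "p \<in> Q" for p using t that by (rule bij_betw_apply)
  have "\<exists>y. \<forall>p\<in>Q. \<forall>q\<in>Q. B.coef y p q = A.coef x (t p) (t q)" for x
    by (rule B.coef_surj) (simp add: linked A.coef_def)
  then obtain f where f: "\<And>x p q. p \<in> Q \<Longrightarrow> q \<in> Q \<Longrightarrow> B.coef (f x) p q = A.coef x (t p) (t q)"
    by metis
  have inj: "inj f"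
  proof (rule injI)
    fix x y assume "f x = f y"
    then have "A.coef x (t p) (t q) = A.coef y (t p) (t q)" if "p \<in> Q" "q \<in> Q" for p q
      using f that by metis
    then show "x = y"
      using t by (intro A.coef_ext) (auto simp: bij_betw_def)
  qed
  have surj: "\<exists>x. f x = y" for y
  proof -
    define s where "s = the_inv_into Q t"
    have s: "s p \<in> Q" "t (s p) = p" if "p \<in> P" for p
      using that t unfolding s_def bij_betw_def
      by (auto simp: f_the_inv_into_f intro: the_inv_into_into)
    have st: "s (t p) = p" if "p \<in> Q" for p
      using that t unfolding s_def bij_betw_def by (simp add: the_inv_into_f_f)
    have "\<exists>x. \<forall>p\<in>P. \<forall>q\<in>P. A.coef x p q = B.coef y (s p) (s q)"
    proof (rule A.coef_surj)
      fix p q assume "p \<in> P" "q \<in> P" "(p, q) \<notin> A.linked"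
      then show "B.coef y (s p) (s q) = 0"
        using linked[of "s p" "s q"] s by (simp add: B.coef_def)
    qed
    then obtain x where "\<And>p q. p \<in> P \<Longrightarrow> q \<in> P \<Longrightarrow> A.coef x p q = B.coef y (s p) (s q)" by blast
    then have "f x = y"
      using f tP st by (intro B.coef_ext) simp
    then show ?thesis by blast
  qed
  have "star_isomorphism f"
    unfolding star_isomorphism_def
  proof (intro conjI allI)
    show "bij f" using inj surj by (metis bijI surjI)
    have "f (x + y) = f x + f y" for x y
      by (rule B.coef_ext) (simp add: f A.coef_add B.coef_add)
    moreover have "f (c *\<^sub>C x) = c *\<^sub>C f x" for c x
      by (rule B.coef_ext) (simp add: f A.coef_scaleC B.coef_scaleC)
    ultimately show "Vector_Spaces.linear scaleC scaleC f"
      by unfold_locales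
    show "f 1 = 1"
      using t by (intro B.coef_ext) (auto simp: f A.coef_one B.coef_one tP bij_betw_def inj_on_def)
    show "f (star x) = star (f x)" for x
      by (rule B.coef_ext) (simp add: f A.coef_star B.coef_star)
    show "f (x * y) = f x * f y" for x y
      by (rule B.coef_ext)
        (simp add: f tP A.coef_mult B.coef_mult flip: sum.reindex_bij_betw[OF t])
  qed
  then show ?thesis by blast
qed

section \<open>Recovering the equivalence of minimal projections from the order\<close>

definition edges :: "'a set \<Rightarrow> 'a set set"
  where "edges X = {e. e \<subseteq> X \<and> card e = 2}"

definition coatoms :: "'a::order set \<Rightarrow> 'a \<Rightarrow> 'a set"
  where "coatoms L m = {d \<in> L. d < m \<and> (\<forall>x\<in>L. d \<le> x \<longrightarrow> x < m \<longrightarrow> x = d)}"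

lemma edges_cases:
  assumes "e \<in> edges X"
  obtains p q where "e = {p, q}" "p \<noteq> q" "p \<in> X" "q \<in> X"
  using assms by (auto simp: edges_def card_2_iff)

lemma edgesI: "p \<in> X \<Longrightarrow> q \<in> X \<Longrightarrow> p \<noteq> q \<Longrightarrow> {p, q} \<in> edges X"
  by (simp add: edges_def)

lemma Int_mem_comm_cstar_subalgebras:
  assumes "C \<in> comm_cstar_subalgebras" "D \<in> comm_cstar_subalgebras"
  shows "C \<inter> D \<in> comm_cstar_subalgebras"
  using assms
  by (auto simp: comm_cstar_subalgebras_def cstar_subalgebra_def complex_vector.subspace_inter
      intro: closed_Int)

locale masa_frame = minimal_frame +
  assumes masa_commutant: "masa (commutant P)"
begin

abbreviation "M \<equiv> commutant P"

lemma M_mem: "M \<in> comm_cstar_subalgebras"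
  using masa_commutant by (simp add: masa_def)

lemmas M_closed = comm_cstar_subalgebrasD[OF M_mem]

lemma frame_subset: "P \<subseteq> M"
  using frame_mult by (auto simp: commutant_def)

lemma frame_scalar:
  assumes "x \<in> M" "p \<in> P"
  shows "\<exists>c. x * p = c *\<^sub>C p"
proof -
  have "x * p = p * x * p"
    using commutantD[OF assms] idem[OF assms(2)] by (metis mult.assoc)
  then show ?thesis using minimal[OF assms(2)] by metis
qed

lemma edge_subset: "e \<in> edges P \<Longrightarrow> e \<subseteq> P"
  by (simp add: edges_def)

lemma scalar_on_edge_mem:
  assumes "e \<in> edges P"
  shows "scalar_on M e \<in> comm_cstar_subalgebras"
proof -
  obtain p where "p \<in> e" using assms by (auto elim: edges_cases)
  then show ?thesis
    using edge_subset[OF assms] frame_subset star_frame nonzero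
    by (intro scalar_on_mem[OF M_mem]) auto
qed

text \<open>A member of \<open>e\<close> acts as 1 on itself and as 0 on the other point. Thus
  \<open>e\<close> is recovered from its algebra as the set of projections missing there.\<close>

lemma frame_mem_scalar_on:
  assumes "r \<in> P" "e \<in> edges P"
  shows "r \<in> scalar_on M e \<longleftrightarrow> r \<notin> e"
proof
  assume "r \<notin> e"
  then have "r * g = 0" if "g \<in> e" for g
    using orth[OF assms(1)] that edge_subset[OF assms(2)] by blast
  then show "r \<in> scalar_on M e"
    using assms frame_subset by (auto simp: scalar_on_def intro!: exI[of _ 0])
next
  assume r: "r \<in> scalar_on M e"
  show "r \<notin> e"
  proof
    assume "r \<in> e"
    then obtain q where q: "q \<in> e" "q \<noteq> r" using assms(2) by (auto elim!: edges_cases)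
    obtain c where c: "\<And>g. g \<in> e \<Longrightarrow> r * g = c *\<^sub>C g" using r by (auto simp: scalar_on_def)
    have P: "q \<in> P" using q assms edge_subset by blast
    have "c *\<^sub>C q = 0" using c[OF q(1)] orth[OF assms(1) P] q by simp
    then have "c = 0" using nonzero[OF P] by simp
    then show False using c[OF \<open>r \<in> e\<close>] idem nonzero assms by simp
  qed
qed

lemma scalar_on_edge_subset_iff:
  assumes "e \<in> edges P" "e' \<in> edges P"
  shows "scalar_on M e \<subseteq> scalar_on M e' \<longleftrightarrow> e = e'"
proof
  assume sub: "scalar_on M e \<subseteq> scalar_on M e'"
  have "e' \<subseteq> e"
    using sub frame_mem_scalar_on assms edge_subset by (metis subsetD subsetI)
  moreover have "finite e" "card e = card e'"
    using assms by (auto simp: edges_def intro: card_ge_0_finite)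
  ultimately show "e = e'" by (metis card_subset_eq)
qed simp

lemma scalar_on_edge_psubset:
  assumes "e \<in> edges P"
  shows "scalar_on M e \<subset> M"
proof -
  obtain p where "p \<in> e" using assms by (auto elim: edges_cases)
  then have "p \<in> M" "p \<notin> scalar_on M e"
    using assms edge_subset frame_subset frame_mem_scalar_on by blast+
  moreover have "scalar_on M e \<subseteq> M" by (auto simp: scalar_on_def)
  ultimately show ?thesis by blast
qed

text \<open>If \<open>D\<close> separates every two members of \<open>P\<close>, Lagrange interpolation shows \<open>P \<subseteq> D\<close>.\<close>

lemma subset_scalar_on_edge:
  assumes D: "D \<in> comm_cstar_subalgebras" "D \<subset> M"
  shows "\<exists>e\<in>edges P. D \<subseteq> scalar_on M e"
proof (rule ccontr)
  assume neg: "\<not> ?thesis"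
  note DD = comm_cstar_subalgebrasD[OF D(1)]
  have sep: "\<exists>z\<in>D. z * p = p \<and> z * q = 0" if pq: "p \<in> P" "q \<in> P" "p \<noteq> q" for p q
  proof -
    have "\<not> D \<subseteq> scalar_on M {p, q}" using neg edgesI[OF pq] by auto
    then obtain d where d: "d \<in> D" "d \<notin> scalar_on M {p, q}" by blast
    then have dM: "d \<in> M" using D by blast
    obtain a b where ab: "d * p = a *\<^sub>C p" "d * q = b *\<^sub>C q"
      using frame_scalar[OF dM] pq by meson
    have "a \<noteq> b" using d(2) dM ab by (auto simp: scalar_on_def)
    show ?thesis
    proof (intro bexI conjI)
      \<comment> \<open>The Lagrange factor with value 1 at \<open>p\<close> and 0 at
        \<open>q\<close>.\<close>
      let ?z = "inverse (a - b) *\<^sub>C (d - b *\<^sub>C 1)"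
      show "?z \<in> D" by (intro DD(9) DD(8) DD(5) d(1))
      show "?z * p = p"
        using ab \<open>a \<noteq> b\<close>
        by (simp add: mult_scaleC_left left_diff_distrib scaleC_scaleC flip: scaleC_diff_left)
      show "?z * q = 0"
        using ab by (simp add: mult_scaleC_left left_diff_distrib)
    qed
  qed
  have interp: "\<exists>y\<in>D. y * p = p \<and> (\<forall>q\<in>S. y * q = 0)"
    if "p \<in> P" "S \<subseteq> P - {p}" "finite S" for p S
    using that(3,2)
  proof (induction S rule: finite_induct)
    case empty
    show ?case using DD(5) by (intro bexI[of _ 1]) auto
  next
    case (insert q S)
    then obtain y where y: "y \<in> D" "y * p = p" "\<And>q. q \<in> S \<Longrightarrow> y * q = 0" by auto
    obtain z where z: "z \<in> D" "z * p = p" "z * q = 0"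
      using sep[of p q] insert.prems \<open>p \<in> P\<close> by auto
    have "z * y * p = p" using y z by (simp add: mult.assoc)
    moreover have "z * y * r = 0" if "r \<in> S" for r using y(3)[OF that] by (simp add: mult.assoc)
    moreover have "z * y * q = 0"
      using DD(6)[OF z(1) y(1)] z(3) by (simp add: mult.assoc)
    ultimately show ?case using DD(2)[OF z(1) y(1)] by (intro bexI[of _ "z * y"]) auto
  qed
  have "P \<subseteq> D"
  proof
    fix p assume p: "p \<in> P"
    then obtain y where y: "y \<in> D" "y * p = p" "\<And>q. q \<in> P - {p} \<Longrightarrow> y * q = 0"
      using interp[of p "P - {p}"] finite_frame by auto
    have "y = (\<Sum>q\<in>P. y * q)" by (simp add: sum_mult_right)
    also have "\<dots> = y * p" using y p finite_frame by (simp add: sum.remove)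
    finally show "p \<in> D" using y by simp
  qed
  have "M \<subseteq> D"
  proof
    fix x assume x: "x \<in> M"
    have "(\<Sum>q\<in>P. x * q) \<in> D"
    proof (rule complex_vector.subspace_sum[OF DD(1)])
      fix q assume "q \<in> P"
      then show "x * q \<in> D" using frame_scalar[OF x] DD(9) \<open>P \<subseteq> D\<close> by (metis subsetD)
    qed
    then show "x \<in> D" by (simp add: sum_mult_right)
  qed
  then show False using D by blast
qed

text \<open>By \<open>subset_scalar_on_edge\<close> every member strictly below \<open>M\<close>
  lies under one of these algebras, and by \<open>scalar_on_edge_subset_iff\<close> distinct ones
  are incomparable.\<close>

lemma coatoms_eq: "coatoms comm_cstar_subalgebras M = scalar_on M ` edges P"
proof
  show "coatoms comm_cstar_subalgebras M \<subseteq> scalar_on M ` edges P"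
  proof
    fix D assume "D \<in> coatoms comm_cstar_subalgebras M"
    then have D: "D \<in> comm_cstar_subalgebras" "D \<subset> M"
      "\<And>E. E \<in> comm_cstar_subalgebras \<Longrightarrow> D \<subseteq> E \<Longrightarrow> E \<subset> M \<Longrightarrow> E = D"
      by (simp_all add: coatoms_def)
    obtain e where e: "e \<in> edges P" "D \<subseteq> scalar_on M e"
      using subset_scalar_on_edge[OF D(1,2)] by blast
    have "scalar_on M e = D"
      using D(3)[OF scalar_on_edge_mem[OF e(1)] e(2) scalar_on_edge_psubset[OF e(1)]] .
    then show "D \<in> scalar_on M ` edges P" using e by blast
  qed
  show "scalar_on M ` edges P \<subseteq> coatoms comm_cstar_subalgebras M"
  proof clarify
    fix e assume e: "e \<in> edges P"
    have "E = scalar_on M e"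
      if E: "E \<in> comm_cstar_subalgebras" "scalar_on M e \<subseteq> E" "E \<subset> M" for E
    proof -
      obtain e' where e': "e' \<in> edges P" "E \<subseteq> scalar_on M e'"
        using subset_scalar_on_edge[OF E(1,3)] by blast
      then have "e = e'" using scalar_on_edge_subset_iff[OF e e'(1)] E(2) by (meson order_trans)
      then show ?thesis using E(2) e'(2) by blast
    qed
    then show "scalar_on M e \<in> coatoms comm_cstar_subalgebras M"
      using scalar_on_edge_mem[OF e] scalar_on_edge_psubset[OF e] by (simp add: coatoms_def)
  qed
qed

text \<open>For a partial isometry \<open>v\<close> between the two projections, the self-adjoint
  \<open>v + star v\<close> commutes with \<open>scalar_on M e\<close> but lies outside
  \<open>M\<close>. Conversely, an \<open>x\<close> commuting with \<open>scalar_on M e\<close>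
  commutes with \<open>p + q\<close> and with every projection outside \<open>e\<close>; if its
  corners between \<open>p\<close> and \<open>q\<close> vanished, it would commute with
  \<open>p\<close> and \<open>q\<close> too and lie in \<open>M\<close>.\<close>

lemma linked_edge_iff:
  assumes e: "e \<in> edges P"
  shows "e \<times> e \<subseteq> linked \<longleftrightarrow> (\<exists>N\<in>comm_cstar_subalgebras. scalar_on M e \<subseteq> N \<and> \<not> N \<subseteq> M)"
    (is "_ \<longleftrightarrow> ?R")
proof -
  obtain p q where pq: "e = {p, q}" "p \<noteq> q" "p \<in> P" "q \<in> P" using e by (rule edges_cases)
  have sub: "e \<times> e \<subseteq> linked \<longleftrightarrow> (p, q) \<in> linked"
    using equiv_linked pq by (auto simp: equiv_def refl_on_def dest: symD)
  show ?thesis unfolding sub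
  proof
    assume "(p, q) \<in> linked"
    then obtain v where v: "p * v = v" "v * q = v" "star v * v = q"
      using partial_isometry by blast
    have "v \<noteq> 0" using v nonzero[OF pq(4)] by auto
    define h where "h = v + star v"
    have sv: "q * star v = star v" "star v * p = star v"
      using arg_cong[OF v(2), of star] arg_cong[OF v(1), of star] pq by (simp_all add: star_mult star_frame)
    have comm: "x * h = h * x" if x: "x \<in> scalar_on M e" for x
    proof -
      obtain c where c: "x * p = c *\<^sub>C p" "x * q = c *\<^sub>C q" and xM: "x \<in> M"
        using x pq by (auto simp: scalar_on_def)
      have c': "p * x = c *\<^sub>C p" "q * x = c *\<^sub>C q"
        using c commutantD[OF xM] pq by auto
      have "x * v = c *\<^sub>C v" "x * star v = c *\<^sub>C star v" "v * x = c *\<^sub>C v" "star v * x = c *\<^sub>C star v"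
        using arg_cong[OF c(1), of "\<lambda>y. y * v"] arg_cong[OF c(2), of "\<lambda>y. y * star v"]
          arg_cong[OF c'(2), of "(*) v"] arg_cong[OF c'(1), of "(*) (star v)"]
        by (simp_all add: mult.assoc v sv mult_scaleC_left mult_scaleC_right)
          (simp_all add: v sv flip: mult.assoc)
      then show ?thesis by (simp add: h_def distrib_left distrib_right)
    qed
    let ?S = "insert h (scalar_on M e)" let ?N = "commutant (commutant ?S)"
    note E = comm_cstar_subalgebrasD[OF scalar_on_edge_mem[OF e]]
    have "star h = h" by (simp add: h_def star_add star_star add.commute)
    then have "?N \<in> comm_cstar_subalgebras"
      using E comm by (intro bicommutant_mem) auto
    moreover have "?S \<subseteq> ?N" by (rule subset_bicommutant)
    moreover have "h \<notin> M"
    proof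
      assume "h \<in> M"
      then have "p * h * q = h * p * q" using commutantD[OF _ pq(3)] by simp
      then have "p * h * q = 0" using orth pq by (simp add: mult.assoc)
      moreover have "p * star v * q = 0"
        using sv orth[OF pq(3,4,2)] by (metis mult.assoc mult_zero_left)
      ultimately show False
        using v \<open>v \<noteq> 0\<close> by (simp add: h_def distrib_left distrib_right)
    qed
    ultimately show ?R by blast
  next
    assume ?R
    then obtain N x where N: "N \<in> comm_cstar_subalgebras" "scalar_on M e \<subseteq> N" "x \<in> N" "x \<notin> M"
      by blast
    have comm: "x * y = y * x" if "y \<in> scalar_on M e" for y
      using comm_cstar_subalgebrasD(6)[OF N(1)] N that by blast
    have off: "r * x = x * r" if "r \<in> P" "r \<notin> e" for r
      using comm[of r] frame_mem_scalar_on[OF that(1) e] that(2) by simp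
    have pqx: "(p + q) * x = x * (p + q)"
    proof -
      have "p + q \<in> M" by (intro M_closed(7)) (use pq frame_subset in auto)
      moreover have "(p + q) * p = p" "(p + q) * q = q"
        using pq by (auto simp: distrib_right frame_mult)
      ultimately have "p + q \<in> scalar_on M e"
        unfolding scalar_on_def pq(1) by (auto intro!: exI[of _ 1])
      then show ?thesis using comm by simp
    qed
    show "(p, q) \<in> linked"
    proof (rule ccontr)
      assume "(p, q) \<notin> linked"
      then have "p * x * q = 0" "q * x * p = 0"
        using linkedI pq equiv_linked by (metis equivE symD)+
      then have "p * x = p * x * p" "x * p = p * x * p" "q * x = q * x * q" "x * q = q * x * q"
        using arg_cong[OF pqx, of "(*) p"] arg_cong[OF pqx, of "(*) q"]
          arg_cong[OF pqx, of "\<lambda>y. y * p"] arg_cong[OF pqx, of "\<lambda>y. y * q"]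
          pq orth[OF pq(3,4,2)] orth[OF pq(4,3)]
        by (simp_all add: distrib_left distrib_right frame_mult_left mult.assoc frame_mult)
      then have "x * r = r * x" if "r \<in> P" for r
        using off[OF that] pq by (cases "r \<in> e") auto
      then show False using N(4) by (simp add: commutant_def)
    qed
  qed
qed

text \<open>Equal values at \<open>p\<close>, \<open>q\<close> and at \<open>q\<close>,
  \<open>r\<close> force equal values at \<open>p\<close>, \<open>r\<close>, which gives the third
  edge when two edges meet. For disjoint edges with \<open>e = {p, q}\<close>, the element
  \<open>p + q\<close> is scalar on both but separates \<open>e\<close> from \<open>e'\<close>,
  while a third edge below their meet would have a point in each.\<close>

lemma edges_meet_iff:
  assumes e: "e \<in> edges P" and e': "e' \<in> edges P" and ne: "e \<noteq> e'"
  shows "e \<inter> e' \<noteq> {} \<longleftrightarrow> (\<exists>k\<in>edges P. k \<noteq> e \<and> k \<noteq> e' \<and>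
    (\<forall>D\<in>comm_cstar_subalgebras. D \<subseteq> scalar_on M e \<longrightarrow> D \<subseteq> scalar_on M e' \<longrightarrow> D \<subseteq> scalar_on M k))"
proof
  assume "e \<inter> e' \<noteq> {}"
  then obtain q where q: "q \<in> e" "q \<in> e'" by blast
  obtain p where p: "e = {p, q}" "p \<noteq> q" "p \<in> P"
    using e q by (auto elim!: edges_cases)
  obtain r where r: "e' = {r, q}" "r \<noteq> q" "r \<in> P"
    using e' q by (auto elim!: edges_cases)
  have pr: "p \<noteq> r" using p r ne by auto
  show "\<exists>k\<in>edges P. k \<noteq> e \<and> k \<noteq> e' \<and>
    (\<forall>D\<in>comm_cstar_subalgebras. D \<subseteq> scalar_on M e \<longrightarrow> D \<subseteq> scalar_on M e' \<longrightarrow> D \<subseteq> scalar_on M k)"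
  proof (intro bexI conjI ballI impI)
    show "{p, r} \<in> edges P" using p r pr by (intro edgesI)
    show "{p, r} \<noteq> e" "{p, r} \<noteq> e'" using p r pr by auto
    fix D assume D: "D \<subseteq> scalar_on M e" "D \<subseteq> scalar_on M e'"
    have "q \<noteq> 0" using q e edge_subset nonzero by blast
    show "D \<subseteq> scalar_on M {p, r}"
    proof
      fix x assume "x \<in> D"
      then have x: "x \<in> scalar_on M {p, q}" "x \<in> scalar_on M {r, q}" using D p r by auto
      then obtain c d where "\<forall>g\<in>{p, q}. x * g = c *\<^sub>C g" "\<forall>g\<in>{r, q}. x * g = d *\<^sub>C g"
        unfolding scalar_on_def by blast
      then have cd: "x * p = c *\<^sub>C p" "x * q = c *\<^sub>C q" "x * r = d *\<^sub>C r" "x * q = d *\<^sub>C q"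
        by simp_all
      then have "c *\<^sub>C q = d *\<^sub>C q" by metis
      then have "c = d" using \<open>q \<noteq> 0\<close> by (simp add: scaleC_cancel_right)
      then show "x \<in> scalar_on M {p, r}" using cd x by (auto simp: scalar_on_def)
    qed
  qed
next
  assume "\<exists>k\<in>edges P. k \<noteq> e \<and> k \<noteq> e' \<and>
    (\<forall>D\<in>comm_cstar_subalgebras. D \<subseteq> scalar_on M e \<longrightarrow> D \<subseteq> scalar_on M e' \<longrightarrow> D \<subseteq> scalar_on M k)"
  then obtain k where k: "k \<in> edges P" "k \<noteq> e" "k \<noteq> e'"
    "scalar_on M e \<inter> scalar_on M e' \<subseteq> scalar_on M k"
    using Int_mem_comm_cstar_subalgebras[OF scalar_on_edge_mem[OF e] scalar_on_edge_mem[OF e']]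
    by (metis inf_le1 inf_le2)
  show "e \<inter> e' \<noteq> {}"
  proof
    assume disj: "e \<inter> e' = {}"
    \<comment> \<open>A projection outside both edges lies in both algebras, hence in that of
      \<open>k\<close>, and so is not in \<open>k\<close>.\<close>
    have kk: "k \<subseteq> e \<union> e'"
    proof
      fix r assume "r \<in> k"
      then have "r \<in> P" "r \<notin> scalar_on M k"
        using k(1) edge_subset frame_mem_scalar_on by blast+
      then show "r \<in> e \<union> e'" using k(4) frame_mem_scalar_on e e' by blast
    qed
    have sub: "k \<subseteq> a \<Longrightarrow> k = a" if "a \<in> edges P" for a
      using that k(1) by (metis (mono_tags) card.infinite card_subset_eq edges_def mem_Collect_eq zero_neq_numeral)
    obtain t u where tu: "k = {t, u}" "t \<noteq> u" "t \<in> P" "u \<in> P" using k(1) by (rule edges_cases)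
    have "\<exists>s\<in>k. \<exists>s'\<in>k. s \<in> e \<and> s' \<in> e' \<and> s \<noteq> s'"
      using kk sub[OF e] sub[OF e'] k(2,3) tu disj by auto
    then obtain s s' where s: "s \<in> k" "s' \<in> k" "s \<in> e" "s' \<in> e'" "s \<noteq> s'" by blast
    obtain p q where pq: "e = {p, q}" "p \<noteq> q" "p \<in> P" "q \<in> P" using e by (rule edges_cases)
    have val: "(p + q) * r = r" if "r \<in> e" for r
      using that pq orth idem by (auto simp: distrib_right)
    have val0: "(p + q) * r = 0" if "r \<in> P" "r \<notin> e" for r
      using that pq orth by (auto simp: distrib_right)
    have "p + q \<in> M" by (intro M_closed(7)) (use pq frame_subset in auto)
    then have "p + q \<in> scalar_on M e" "p + q \<in> scalar_on M e'"
      using val val0 disj edge_subset[OF e'] unfolding scalar_on_def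
      by (auto intro: exI[of _ 1]) (rule exI[of _ 0], auto)
    then have "p + q \<in> scalar_on M k" using k(4) by blast
    then obtain c where c: "\<And>r. r \<in> k \<Longrightarrow> (p + q) * r = c *\<^sub>C r"
      by (auto simp: scalar_on_def)
    have s'P: "s' \<in> P" "s' \<notin> e" using s edge_subset[OF e'] disj by auto
    have "c = 0" using c[OF s(2)] val0[OF s'P] nonzero[OF s'P(1)] by simp
    then have "s = 0" using c[OF s(1)] val[OF s(3)] by simp
    then show False using nonzero s(3) edge_subset[OF e] by blast
  qed
qed

end

section \<open>Equivalence relations determined by their edges\<close>

text \<open>Positivity of \<open>m\<close> matters: both \<open>0 choose 2\<close> and
  \<open>1 choose 2\<close> are 0.\<close>

lemma choose_two_less: "0 < m \<Longrightarrow> m < n \<Longrightarrow> m choose 2 < n choose 2"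
proof (induction n)
  case (Suc n)
  have "Suc n choose 2 = n + (n choose 2)" by (simp add: numeral_2_eq_2)
  then show ?case using Suc by (cases "m = n") auto
qed simp

lemma choose_two_inj: "0 < m \<Longrightarrow> 0 < n \<Longrightarrow> m choose 2 = n choose 2 \<Longrightarrow> m = n"
  using choose_two_less by (metis less_irrefl nat_neq_iff)

lemma card_edges: "finite X \<Longrightarrow> card (edges X) = card X choose 2"
  by (simp add: edges_def n_subsets)

text \<open>Any edge provides a second point to pair with a given one; a one-point set has no edges
  and could not be recovered.\<close>

lemma Union_edges:
  assumes "e \<in> edges X"
  shows "\<Union>(edges X) = X"
proof
  show "X \<subseteq> \<Union>(edges X)"
  proof
    fix x assume x: "x \<in> X"
    obtain p q where "e = {p, q}" "p \<noteq> q" "p \<in> X" "q \<in> X" using assms by (rule edges_cases)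
    then obtain y where "y \<in> X" "y \<noteq> x" by metis
    then show "x \<in> \<Union>(edges X)" using x edgesI[of x X y] by blast
  qed
qed (auto simp: edges_def)

lemma equiv_bij_from_class_bij:
  assumes r: "equiv P r" and s: "equiv Q s" and fin: "finite P"
    and b: "bij_betw b (P // r) (Q // s)" and card: "\<And>X. X \<in> P // r \<Longrightarrow> card (b X) = card X"
  shows "\<exists>t. bij_betw t P Q \<and> (\<forall>p\<in>P. \<forall>q\<in>P. (t p, t q) \<in> s \<longleftrightarrow> (p, q) \<in> r)"
proof -
  have bQ: "b X \<in> Q // s" if "X \<in> P // r" for X using b that by (rule bij_betw_apply)
  have finX: "finite X" if "X \<in> P // r" for X
    using that r fin by (metis Union_quotient Sup_upper finite_subset)
  have "\<exists>h. bij_betw h X (b X)" if X: "X \<in> P // r" for X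
  proof (rule finite_same_card_bij)
    have "X \<noteq> {}" using X r by (meson in_quotient_imp_non_empty)
    \<comment> \<open>Infinite sets have \<open>card\<close> 0, so this makes \<open>b X\<close>
      finite.\<close>
    then have "card (b X) \<noteq> 0" using card[OF X] finX[OF X] by simp
    then show "finite (b X)" by (meson card.infinite)
    show "finite X" "card X = card (b X)" using finX[OF X] card[OF X] by simp_all
  qed
  then obtain h where h: "\<And>X. X \<in> P // r \<Longrightarrow> bij_betw (h X) X (b X)" by metis
  define t where "t = (\<lambda>p. h (r `` {p}) p)"
  have cls: "r `` {p} \<in> P // r" "p \<in> r `` {p}" if "p \<in> P" for p
    by (rule quotientI[OF that], rule equiv_class_self[OF r that])
  have tb: "t p \<in> b (r `` {p})" if "p \<in> P" for p
    unfolding t_def using h[OF cls(1)[OF that]] cls(2)[OF that] by (rule bij_betw_apply)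
  have eqv: "(t p, t q) \<in> s \<longleftrightarrow> (p, q) \<in> r" if p: "p \<in> P" and q: "q \<in> P" for p q
  proof -
    have "(t p, t q) \<in> s \<longleftrightarrow> b (r `` {p}) = b (r `` {q})"
      using quotient_eq_iff[OF s bQ[OF cls(1)[OF p]] bQ[OF cls(1)[OF q]] tb[OF p] tb[OF q]] by simp
    also have "\<dots> \<longleftrightarrow> r `` {p} = r `` {q}"
      using b cls(1) p q by (metis bij_betw_def inj_onD)
    also have "\<dots> \<longleftrightarrow> (p, q) \<in> r" using eq_equiv_class_iff[OF r p q] .
    finally show ?thesis .
  qed
  have "bij_betw t P Q"
    unfolding bij_betw_def
  proof
    show "inj_on t P"
    proof (rule inj_onI)
      fix p q assume pq: "p \<in> P" "q \<in> P" "t p = t q"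
      have "t p \<in> Q" using tb[OF pq(1)] bQ[OF cls(1)[OF pq(1)]] s by (metis Union_iff Union_quotient)
      then have "(t p, t q) \<in> s" using s pq(3) by (auto simp: equiv_def refl_on_def)
      then have "r `` {p} = r `` {q}" using eqv pq r equiv_class_eq by metis
      then show "p = q"
        using pq(3) h[OF cls(1)[OF pq(1)]] cls(2)[OF pq(1)] cls(2)[OF pq(2)]
        unfolding t_def bij_betw_def by (metis inj_onD)
    qed
    show "t ` P = Q"
    proof
      show "t ` P \<subseteq> Q" using tb bQ cls(1) s by (metis Union_iff Union_quotient image_subsetI)
      show "Q \<subseteq> t ` P"
      proof
        fix y assume y: "y \<in> Q"
        then have "s `` {y} \<in> b ` (P // r)" using b by (simp add: bij_betw_def quotientI)
        then obtain X where X: "X \<in> P // r" "b X = s `` {y}" by auto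
        then have "y \<in> b X" using equiv_class_self[OF s y] by simp
        then have "y \<in> h X ` X" using bij_betw_imp_surj_on[OF h[OF X(1)]] by simp
        then obtain x where x: "x \<in> X" "h X x = y" by auto
        have "x \<in> P" using x X r by (metis Union_iff Union_quotient)
        moreover have "r `` {x} = X" using X(1) x(1) r by (metis equiv_class_eq_iff quotientE Image_singleton_iff)
        ultimately show "y \<in> t ` P" using x by (auto simp: t_def)
      qed
    qed
  qed
  then show ?thesis using eqv by blast
qed

lemma edge_in_class:
  assumes "equiv V v" "e \<in> edges V" "e \<times> e \<subseteq> v"
  shows "\<exists>X\<in>V // v. e \<in> edges X"
proof -
  obtain p q where pq: "e = {p, q}" "p \<noteq> q" "p \<in> V" "q \<in> V" using assms(2) by (rule edges_cases)
  then have "e \<in> edges (v `` {p})" using assms by (auto simp: edges_def)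
  then show ?thesis using pq by (auto intro: quotientI)
qed

lemma card_class_without_edges:
  assumes "equiv V v" "X \<in> V // v" "edges X = {}"
  shows "card X = 1"
proof -
  obtain x where x: "x \<in> X" using assms in_quotient_imp_non_empty by blast
  then have "X = {x}" using edgesI[of x X] assms(3) by blast
  then show ?thesis by simp
qed

text \<open>Classes without edges are singletons, so their total size equals their number.\<close>

lemma card_partition_edges:
  assumes v: "equiv V v" and fin: "finite V"
  shows "card V = sum card {X \<in> V // v. edges X \<noteq> {}} + card (V // v - {X \<in> V // v. edges X \<noteq> {}})"
proof -
  let ?B = "{X \<in> V // v. edges X \<noteq> {}}"
  have finq: "finite (V // v)" using finite_quotient[OF fin equiv_type[OF v]] .
  have "card (\<Union>(V // v)) = sum card (V // v)"
  proof (rule card_Union_disjoint)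
    show "pairwise disjnt (V // v)"
      using quotient_disj[OF v] by (auto simp: pairwise_def disjnt_def)
    show "finite X" if "X \<in> V // v" for X
      using in_quotient_imp_subset[OF v that] fin by (rule finite_subset)
  qed
  also have "\<dots> = sum card ?B + sum card (V // v - ?B)"
    using sum.subset_diff[of ?B "V // v" card] finq by (simp add: add.commute)
  also have "sum card (V // v - ?B) = card (V // v - ?B)"
    unfolding card_eq_sum[of "V // v - ?B"]
    by (rule sum.cong) (use card_class_without_edges[OF v] in auto)
  finally show ?thesis using Union_quotient[OF v] by simp
qed

text \<open>Membership in the class of \<open>e\<close>, phrased through edges and their
  intersections only, so that an incidence-preserving bijection carries it along. One intermediate
  \<open>l\<close> suffices even for disjoint edges of a class: it joins a point of each.\<close>

definition near_edges :: "'a set \<Rightarrow> ('a \<times> 'a) set \<Rightarrow> 'a set \<Rightarrow> 'a set set"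
  where "near_edges V v e = {k \<in> edges V. k \<times> k \<subseteq> v \<and>
    (\<exists>l\<in>edges V. l \<times> l \<subseteq> v \<and> l \<inter> e \<noteq> {} \<and> l \<inter> k \<noteq> {})}"

lemma near_edges_eq:
  assumes r: "equiv P r" and X: "X \<in> P // r" and e: "e \<in> edges X"
  shows "near_edges P r e = edges X" (is "?N = _")
proof
  have XP: "X \<subseteq> P" using r X by (metis Union_quotient Sup_upper)
  have XX: "a \<in> X \<Longrightarrow> b \<in> X \<Longrightarrow> (a, b) \<in> r" for a b using r X by (meson in_quotient_imp_in_rel empty_subsetI insert_subset)
  have closed: "(a, b) \<in> r \<Longrightarrow> a \<in> X \<Longrightarrow> b \<in> X" for a b using r X by (meson in_quotient_imp_closed)
  have in_class: "k \<in> edges X" if k: "k \<in> edges P" "k \<times> k \<subseteq> r" "a \<in> k" "a \<in> X" for k a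
    using k closed by (auto simp: edges_def)
  show "?N \<subseteq> edges X"
  proof
    fix k assume "k \<in> ?N"
    then obtain l a b where k: "k \<in> edges P" "k \<times> k \<subseteq> r" "l \<in> edges P" "l \<times> l \<subseteq> r"
      "a \<in> l" "a \<in> e" "b \<in> l" "b \<in> k" by (auto simp: near_edges_def)
    have "a \<in> X" using k e by (auto simp: edges_def)
    then have "l \<in> edges X" using in_class k by blast
    then have "b \<in> X" using k by (auto simp: edges_def)
    then show "k \<in> edges X" using in_class k by blast
  qed
  show "edges X \<subseteq> ?N"
  proof
    fix k assume k: "k \<in> edges X"
    have sub: "l \<in> edges P \<and> l \<times> l \<subseteq> r" if "l \<in> edges X" for l
      using that XP XX by (auto simp: edges_def)
    obtain a where a: "a \<in> e" "a \<in> X" using e by (auto elim!: edges_cases)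
    obtain b where b: "b \<in> k" "b \<in> X" using k by (auto elim!: edges_cases)
    \<comment> \<open>\<open>{a, b}\<close> serves if the points differ, and \<open>e\<close> itself
      if they agree.\<close>
    have "\<exists>l\<in>edges X. a \<in> l \<and> b \<in> l"
      using a b e edgesI[of a X b] by (cases "a = b") auto
    then show "k \<in> ?N" using sub[OF k] sub a b unfolding near_edges_def by blast
  qed
qed

text \<open>Through \<open>near_edges\<close>, the map \<open>\<phi>\<close> carries the edge set of
  a class onto the edge set of a class, and edge counts give equal sizes. Nonemptiness of
  \<open>P\<close> and \<open>Q\<close> allows the numbers of points to be compared through the
  numbers of pairs, and the remaining classes are matched by subtraction.\<close>

theorem equiv_bij_from_edge_bij:
  assumes r: "equiv P r" and s: "equiv Q s" and fin: "finite P" "finite Q" and ne: "P \<noteq> {}" "Q \<noteq> {}"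
    and phi: "bij_betw \<phi> (edges P) (edges Q)"
    and rel: "\<And>e. e \<in> edges P \<Longrightarrow> \<phi> e \<times> \<phi> e \<subseteq> s \<longleftrightarrow> e \<times> e \<subseteq> r"
    and adj: "\<And>e k. e \<in> edges P \<Longrightarrow> k \<in> edges P \<Longrightarrow> \<phi> e \<inter> \<phi> k \<noteq> {} \<longleftrightarrow> e \<inter> k \<noteq> {}"
  shows "\<exists>t. bij_betw t P Q \<and> (\<forall>p\<in>P. \<forall>q\<in>P. (t p, t q) \<in> s \<longleftrightarrow> (p, q) \<in> r)"
proof -
  have phiQ: "\<phi> e \<in> edges Q" if "e \<in> edges P" for e using phi that by (rule bij_betw_apply)
  have phi_surj: "\<exists>e\<in>edges P. \<phi> e = k" if "k \<in> edges Q" for k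
  proof -
    have "k \<in> \<phi> ` edges P" using that bij_betw_imp_surj_on[OF phi] by simp
    then show ?thesis by auto
  qed
  have near_iff: "\<phi> k \<in> near_edges Q s (\<phi> e) \<longleftrightarrow> k \<in> near_edges P r e"
    if k: "k \<in> edges P" and e: "e \<in> edges P" for k e
  proof -
    have "(\<exists>l\<in>edges Q. l \<times> l \<subseteq> s \<and> l \<inter> \<phi> e \<noteq> {} \<and> l \<inter> \<phi> k \<noteq> {}) \<longleftrightarrow>
        (\<exists>l\<in>edges P. \<phi> l \<times> \<phi> l \<subseteq> s \<and> \<phi> l \<inter> \<phi> e \<noteq> {} \<and> \<phi> l \<inter> \<phi> k \<noteq> {})"
      using bij_betw_imp_surj_on[OF phi, symmetric] by (simp only: bex_simps)
    also have "\<dots> \<longleftrightarrow> (\<exists>l\<in>edges P. l \<times> l \<subseteq> r \<and> l \<inter> e \<noteq> {} \<and> l \<inter> k \<noteq> {})"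
      by (rule bex_cong[OF refl]) (simp only: rel adj[OF _ e] adj[OF _ k])
    finally show ?thesis
      unfolding near_edges_def mem_Collect_eq using rel[OF k] phiQ[OF k] k by simp
  qed
  have phi_near: "\<phi> ` near_edges P r e = near_edges Q s (\<phi> e)"
    if e: "e \<in> edges P" for e
  proof
    show "\<phi> ` near_edges P r e \<subseteq> near_edges Q s (\<phi> e)"
      using near_iff[OF _ e] by (auto simp: near_edges_def[of P])
    show "near_edges Q s (\<phi> e) \<subseteq> \<phi> ` near_edges P r e"
    proof
      fix k' assume k': "k' \<in> near_edges Q s (\<phi> e)"
      then obtain k where "k \<in> edges P" "\<phi> k = k'"
        using phi_surj[of k'] by (auto simp: near_edges_def)
      then show "k' \<in> \<phi> ` near_edges P r e" using near_iff[OF _ e, of k] k' by auto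
    qed
  qed
  define big where "big = {X \<in> P // r. edges X \<noteq> {}}"
  define big' where "big' = {X \<in> Q // s. edges X \<noteq> {}}"
  \<comment> \<open>A class with an edge is the union of its edges, so the image class is the union
    of the images of the edges.\<close>
  define \<psi> where "\<psi> = (\<lambda>X. \<Union>(\<phi> ` edges X))"
  have sub: "edges X \<subseteq> edges P" if "X \<in> P // r" for X
    using that r by (auto simp: edges_def dest: in_quotient_imp_subset)
  have psi: "\<psi> X \<in> big'" "edges (\<psi> X) = \<phi> ` edges X" "card (\<psi> X) = card X"
    if X: "X \<in> big" for X
  proof -
    obtain e where e: "e \<in> edges X" and Xq: "X \<in> P // r" using X by (auto simp: big_def)
    have eP: "e \<in> edges P" "e \<times> e \<subseteq> r"
      using near_edges_eq[OF r Xq e] e by (auto simp: near_edges_def)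
    have "\<phi> e \<times> \<phi> e \<subseteq> s" using rel eP by blast
    then obtain Y where Y: "Y \<in> Q // s" "\<phi> e \<in> edges Y"
      using edge_in_class[OF s phiQ[OF eP(1)]] by blast
    have im: "\<phi> ` edges X = edges Y"
      using phi_near[OF eP(1)] near_edges_eq[OF r Xq e] near_edges_eq[OF s Y] by simp
    then have Yeq: "\<psi> X = Y" using Union_edges[OF Y(2)] by (simp add: \<psi>_def)
    show "\<psi> X \<in> big'" "edges (\<psi> X) = \<phi> ` edges X" using Y im Yeq by (auto simp: big'_def)
    have fin': "finite X" "finite Y"
      using in_quotient_imp_subset[OF r Xq] in_quotient_imp_subset[OF s Y(1)] fin
      by (auto intro: finite_subset)
    have "inj_on \<phi> (edges X)" using phi sub[OF Xq] by (auto simp: bij_betw_def intro: inj_on_subset)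
    then have "card (edges Y) = card (edges X)" using im by (metis card_image)
    moreover have "X \<noteq> {}" "Y \<noteq> {}" using e Y(2) by (auto simp: edges_def)
    ultimately show "card (\<psi> X) = card X"
      unfolding Yeq using fin' by - (rule choose_two_inj, auto simp: card_edges card_gt_0_iff)
  qed
  have psi_bij: "bij_betw \<psi> big big'"
    unfolding bij_betw_def
  proof
    show "inj_on \<psi> big"
    proof (rule inj_onI)
      fix X Y assume XY: "X \<in> big" "Y \<in> big" "\<psi> X = \<psi> Y"
      then have "\<phi> ` edges X = \<phi> ` edges Y" using psi(2) by metis
      moreover have "edges X \<subseteq> edges P" "edges Y \<subseteq> edges P" using XY sub by (auto simp: big_def)
      ultimately have "edges X = edges Y"
        using phi by (metis bij_betw_def inj_on_image_eq_iff)
      moreover obtain e where "e \<in> edges X" using XY(1) by (auto simp: big_def)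
      ultimately show "X = Y" by (metis Union_edges)
    qed
    show "\<psi> ` big = big'"
    proof
      show "\<psi> ` big \<subseteq> big'" using psi(1) by blast
      show "big' \<subseteq> \<psi> ` big"
      proof
        fix Y assume "Y \<in> big'"
        then obtain e' where Y: "Y \<in> Q // s" "e' \<in> edges Y" by (auto simp: big'_def)
        then have e': "e' \<in> edges Q" "e' \<times> e' \<subseteq> s"
          using near_edges_eq[OF s Y] by (auto simp: near_edges_def)
        then obtain e where e: "e \<in> edges P" "\<phi> e = e'" using phi_surj[of e'] by auto
        then obtain X where X: "X \<in> P // r" "e \<in> edges X"
          using edge_in_class[OF r e(1)] rel e' by blast
        have "\<phi> ` edges X = edges Y"
          using phi_near[OF e(1)] near_edges_eq[OF r X] near_edges_eq[OF s Y] e by simp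
        then have "\<psi> X = Y" using Union_edges[OF Y(2)] by (simp add: \<psi>_def)
        then show "Y \<in> \<psi> ` big" using X by (auto simp: big_def)
      qed
    qed
  qed
  have "card (edges P) = card (edges Q)" using phi by (rule bij_betw_same_card)
  then have "card P = card Q"
    using fin ne by - (rule choose_two_inj, auto simp: card_edges card_gt_0_iff)
  moreover have "card P = sum card big + card (P // r - big)"
    unfolding big_def by (rule card_partition_edges[OF r fin(1)])
  moreover have "card Q = sum card big' + card (Q // s - big')"
    unfolding big'_def by (rule card_partition_edges[OF s fin(2)])
  moreover have "sum card big' = sum card big"
    using sum.reindex_bij_betw[OF psi_bij, of card] psi(3) by simp
  ultimately have "card (P // r - big) = card (Q // s - big')" by simp
  moreover have "finite (P // r)" "finite (Q // s)"
    using finite_quotient fin equiv_type[OF r] equiv_type[OF s] by blast+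
  \<comment> \<open>Any bijection will do, because every class without edges has one
    element.\<close>
  ultimately obtain \<theta> where \<theta>: "bij_betw \<theta> (P // r - big) (Q // s - big')"
    using finite_same_card_bij by (metis finite_Diff)
  define b where "b = (\<lambda>X. if X \<in> big then \<psi> X else \<theta> X)"
  have "bij_betw b (big \<union> (P // r - big)) (big' \<union> (Q // s - big'))"
  proof (rule bij_betw_combine)
    show "bij_betw b big big'"
      using psi_bij by (subst bij_betw_cong[of big b \<psi>]) (auto simp: b_def)
    show "bij_betw b (P // r - big) (Q // s - big')"
      using \<theta> by (subst bij_betw_cong[of _ b \<theta>]) (auto simp: b_def)
  qed blast
  moreover have "big \<union> (P // r - big) = P // r" "big' \<union> (Q // s - big') = Q // s"
    by (auto simp: big_def big'_def)
  ultimately have "bij_betw b (P // r) (Q // s)" by simp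
  moreover have "card (b X) = card X" if X: "X \<in> P // r" for X
  proof (cases "X \<in> big")
    case True
    then show ?thesis using psi(3) by (simp add: b_def)
  next
    case False
    then have "\<theta> X \<in> Q // s - big'" using \<theta> X by (auto dest: bij_betwE)
    then show ?thesis
      using False X card_class_without_edges[OF r] card_class_without_edges[OF s]
      by (auto simp: b_def big_def big'_def)
  qed
  ultimately show ?thesis using equiv_bij_from_class_bij[OF r s fin(1)] by blast
qed

section \<open>Transport along the order isomorphism\<close>

lemma coatoms_order_iso:
  fixes f :: "'a::order \<Rightarrow> 'b::order"
  assumes f: "bij_betw f L L'" and le: "\<And>x y. x \<in> L \<Longrightarrow> y \<in> L \<Longrightarrow> f x \<le> f y \<longleftrightarrow> x \<le> y"
    and m: "m \<in> L"
  shows "f ` coatoms L m = coatoms L' (f m)"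
proof -
  have L': "L' = f ` L" using f by (simp add: bij_betw_def)
  have lt: "f x < f y \<longleftrightarrow> x < y" and eq: "f x = f y \<longleftrightarrow> x = y" if "x \<in> L" "y \<in> L" for x y
    using le that by (auto simp: less_le_not_le eq_iff)
  have "f d \<in> coatoms L' (f m) \<longleftrightarrow> d \<in> coatoms L m" if "d \<in> L" for d
    unfolding coatoms_def L' using that m by (simp add: lt le eq)
  moreover have "coatoms L m \<subseteq> L" "coatoms L' (f m) \<subseteq> f ` L"
    by (auto simp: coatoms_def L')
  ultimately show ?thesis by blast
qed

theorem theorem1:
  assumes "finite_dim_cstar TYPE('a::cstar_algebra)"
    and "order_isomorphic
      (comm_cstar_subalgebras :: 'a set set)
      (comm_cstar_subalgebras :: 'b::cstar_algebra set set)"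
  shows "\<exists>f :: 'a \<Rightarrow> 'b. star_isomorphism f"
proof -
  obtain f :: "'a set \<Rightarrow> 'b set" where f: "bij_betw f comm_cstar_subalgebras comm_cstar_subalgebras"
    and le: "\<And>x y. x \<in> comm_cstar_subalgebras \<Longrightarrow> y \<in> comm_cstar_subalgebras \<Longrightarrow> f x \<subseteq> f y \<longleftrightarrow> x \<subseteq> y"
    using order_isomorphic_bij_betw[OF assms(2)] by metis
  have f_mem: "f x \<in> comm_cstar_subalgebras" if "x \<in> comm_cstar_subalgebras" for x
    using f that by (rule bij_betw_apply)
  have f_eq: "f x = f y \<longleftrightarrow> x = y"
    if "x \<in> comm_cstar_subalgebras" "y \<in> comm_cstar_subalgebras" for x y
    using le[OF that] le[OF that(2,1)] by auto
  \<comment> \<open>Quantifiers over the second poset become quantifiers over the range of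
    \<open>f\<close>, after which \<open>le\<close> removes \<open>f\<close>.\<close>
  have image: "comm_cstar_subalgebras = f ` comm_cstar_subalgebras"
    using f by (simp add: bij_betw_def)
  obtain K where K: "chain_bounded TYPE('a) K"
    using finite_dim_chain_bounded[OF assms(1)] .
  have K': "chain_bounded TYPE('b) K"
    using chain_bounded_transfer[OF K f le] .
  obtain M :: "'a set" where M: "masa M"
    using masa_exists[OF K] .
  have MC: "M \<in> comm_cstar_subalgebras" using M by (simp add: masa_def)
  have fM: "masa (f M)"
    unfolding masa_def
  proof (intro conjI ballI impI f_mem MC)
    fix N assume N: "N \<in> comm_cstar_subalgebras" "f M \<subseteq> N"
    then have "N \<in> f ` comm_cstar_subalgebras" using image by simp
    then obtain N' where N': "N' \<in> comm_cstar_subalgebras" "N = f N'" by auto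
    then have "N' = M" using N le[OF MC] M by (simp add: masa_def)
    then show "N = f M" using N' by simp
  qed
  obtain P where P: "minimal_frame P" "M = commutant P"
    using masa_minimal_frame[OF K M] .
  obtain Q where Q: "minimal_frame Q" "f M = commutant Q"
    using masa_minimal_frame[OF K' fM] .
  interpret A: masa_frame P
    using P M by (simp add: masa_frame_def masa_frame_axioms_def)
  interpret B: masa_frame Q
    using Q fM by (simp add: masa_frame_def masa_frame_axioms_def)
  \<comment> \<open>Coatoms below \<open>M\<close> go to coatoms below \<open>f M\<close>; reading
    them as edges on both sides defines \<open>\<phi>\<close>.\<close>
  have coat: "f ` scalar_on M ` edges P = scalar_on (f M) ` edges Q"
    using coatoms_order_iso[OF f le MC] A.coatoms_eq B.coatoms_eq P(2) Q(2) by simp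
  then have "\<forall>e\<in>edges P. \<exists>k\<in>edges Q. f (scalar_on M e) = scalar_on (f M) k" by blast
  then obtain \<phi> where \<phi>: "\<And>e. e \<in> edges P \<Longrightarrow> \<phi> e \<in> edges Q"
    "\<And>e. e \<in> edges P \<Longrightarrow> scalar_on (f M) (\<phi> e) = f (scalar_on M e)"
    by metis
  have mem: "scalar_on M e \<in> comm_cstar_subalgebras" if "e \<in> edges P" for e
    using A.scalar_on_edge_mem[OF that] P(2) by simp
  have inj: "scalar_on M e = scalar_on M k \<longleftrightarrow> e = k" if "e \<in> edges P" "k \<in> edges P" for e k
    using A.scalar_on_edge_subset_iff[OF that] P(2) by auto
  have inj': "scalar_on (f M) e = scalar_on (f M) k \<longleftrightarrow> e = k" if "e \<in> edges Q" "k \<in> edges Q" for e k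
    using B.scalar_on_edge_subset_iff[OF that] Q(2) by auto
  have \<phi>_eq: "\<phi> e = \<phi> k \<longleftrightarrow> e = k" if "e \<in> edges P" "k \<in> edges P" for e k
    using inj[OF that] inj'[OF \<phi>(1)[OF that(1)] \<phi>(1)[OF that(2)]] f_eq[OF mem[OF that(1)] mem[OF that(2)]]
      \<phi>(2)[OF that(1)] \<phi>(2)[OF that(2)] by simp
  have surj: "\<phi> ` edges P = edges Q"
  proof
    show "\<phi> ` edges P \<subseteq> edges Q" using \<phi>(1) by blast
    show "edges Q \<subseteq> \<phi> ` edges P"
    proof
      fix k assume k: "k \<in> edges Q"
      then have "scalar_on (f M) k \<in> f ` scalar_on M ` edges P" using coat by simp
      then obtain e where e: "e \<in> edges P" "scalar_on (f M) k = f (scalar_on M e)" by auto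
      then have "k = \<phi> e" using inj'[OF k \<phi>(1)[OF e(1)]] \<phi>(2)[OF e(1)] by simp
      then show "k \<in> \<phi> ` edges P" using e by simp
    qed
  qed
  have bij: "bij_betw \<phi> (edges P) (edges Q)"
    unfolding bij_betw_def using surj \<phi>_eq by (simp add: inj_on_def)
  \<comment> \<open>The criterion \<open>linked_edge_iff\<close> speaks only of inclusions between
    members of the poset, so it passes through \<open>f\<close>.\<close>
  have rel: "\<phi> e \<times> \<phi> e \<subseteq> B.linked \<longleftrightarrow> e \<times> e \<subseteq> A.linked" if e: "e \<in> edges P" for e
  proof -
    have "\<phi> e \<times> \<phi> e \<subseteq> B.linked \<longleftrightarrow>
      (\<exists>N\<in>f ` comm_cstar_subalgebras. f (scalar_on M e) \<subseteq> N \<and> \<not> N \<subseteq> f M)"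
      using B.linked_edge_iff[OF \<phi>(1)[OF e]] \<phi>(2)[OF e] Q(2) image by simp
    also have "\<dots> \<longleftrightarrow> (\<exists>N\<in>comm_cstar_subalgebras. scalar_on M e \<subseteq> N \<and> \<not> N \<subseteq> M)"
      unfolding bex_simps by (rule bex_cong[OF refl]) (simp add: le mem[OF e] MC)
    also have "\<dots> \<longleftrightarrow> e \<times> e \<subseteq> A.linked"
      using A.linked_edge_iff[OF e] P(2) by simp
    finally show ?thesis .
  qed
  have adj: "\<phi> e \<inter> \<phi> k \<noteq> {} \<longleftrightarrow> e \<inter> k \<noteq> {}" if e: "e \<in> edges P" and k: "k \<in> edges P" for e k
  \<comment> \<open>Equal edges are treated apart, since \<open>edges_meet_iff\<close> concerns
    distinct ones.\<close>
  proof (cases "e = k")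
    case True
    have "e \<noteq> {}" "\<phi> e \<noteq> {}" using e \<phi>(1)[OF e] by (auto simp: edges_def)
    then show ?thesis using True by simp
  next
    case False
    then have ne: "\<phi> e \<noteq> \<phi> k" using \<phi>_eq e k by simp
    have "\<phi> e \<inter> \<phi> k \<noteq> {} \<longleftrightarrow> (\<exists>l\<in>\<phi> ` edges P. l \<noteq> \<phi> e \<and> l \<noteq> \<phi> k \<and>
      (\<forall>D\<in>f ` comm_cstar_subalgebras. D \<subseteq> f (scalar_on M e) \<longrightarrow> D \<subseteq> f (scalar_on M k) \<longrightarrow>
        D \<subseteq> scalar_on (f M) l))"
      using B.edges_meet_iff[OF \<phi>(1)[OF e] \<phi>(1)[OF k] ne] \<phi>(2)[OF e] \<phi>(2)[OF k] Q(2) image surj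
      by simp
    also have "\<dots> \<longleftrightarrow> (\<exists>l\<in>edges P. l \<noteq> e \<and> l \<noteq> k \<and>
      (\<forall>D\<in>comm_cstar_subalgebras. D \<subseteq> scalar_on M e \<longrightarrow> D \<subseteq> scalar_on M k \<longrightarrow> D \<subseteq> scalar_on M l))"
      unfolding bex_simps ball_simps
      by (rule bex_cong[OF refl]) (simp add: \<phi>_eq e k \<phi>(2) le mem)
    also have "\<dots> \<longleftrightarrow> e \<inter> k \<noteq> {}"
      using A.edges_meet_iff[OF e k False] P(2) by simp
    finally show ?thesis .
  qed
  \<comment> \<open>Each frame sums to 1, which an empty sum cannot equal.\<close>
  have "P \<noteq> {}" "Q \<noteq> {}" using A.sum_frame B.sum_frame by auto
  then obtain t where t: "bij_betw t P Q"
    "\<And>p q. p \<in> P \<Longrightarrow> q \<in> P \<Longrightarrow> (t p, t q) \<in> B.linked \<longleftrightarrow> (p, q) \<in> A.linked"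
    using equiv_bij_from_edge_bij[OF A.equiv_linked B.equiv_linked A.finite_frame B.finite_frame _ _ bij rel adj]
    by blast
  \<comment> \<open>The inverse is taken because the relabelling of matrices expects a map from
    \<open>Q\<close> to \<open>P\<close>.\<close>
  define t' where "t' = the_inv_into P t"
  have t': "bij_betw t' Q P" unfolding t'_def using t(1) by (rule bij_betw_the_inv_into)
  have tt': "t (t' q) = q" if "q \<in> Q" for q
    using t(1) that unfolding t'_def bij_betw_def by (simp add: f_the_inv_into_f)
  obtain e where e: "matrix_units P e" using A.matrix_units_exist .
  obtain d where d: "matrix_units Q d" using B.matrix_units_exist .
  show ?thesis
  proof (rule matrix_units_star_isomorphism[OF e d t'])
    fix p q assume "p \<in> Q" "q \<in> Q"
    then show "(t' p, t' q) \<in> A.linked \<longleftrightarrow> (p, q) \<in> B.linked"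
      using t(2)[of "t' p" "t' q"] tt' bij_betw_apply[OF t'] by simp
  qed
qed

end
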